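(* Let $\xi=\{\xi(t),t\in\mathbb R\}$ be a Piranashvili process with covariance $B(t,s)$, exponentially bounded kernel function $f(t,\lambda)$, spectral distribution $F_\xi$ on $\Lambda\subseteq\mathbb R$ and exponential type $\gamma$. Let $w>\gamma$, and put $$\widetilde L_f:=\sup_{t\in\mathbb R}\sup_{\lambda\in\Lambda}|f(t,\lambda)|<\infty,\qquad \widetilde L_0(t):=\frac{4\,\widetilde L_f\,w\,|\sin(wt)|}{\pi(w-\gamma)(1-e^{-\pi})}.$$ Assume $B\in C^2(\mathbb R^2)$ and $\sup_{t\in\mathbb R}|B''(t,t)|<\infty$. Let $p>1$, $\frac1p+\frac1q=1$, and $$\mathsf C_q(t):=\Big(1+\frac{2^{q+1}|\sin(wt)|^q}{\pi^q}\,\lambda(q)\Big)^{2/q},\qquad \lambda(q):=\sum_{n=1}^\infty\frac1{(2n-1)^q}.$$ Let $\mathcal A_{\mathbf u,N}(\xi;t)$ be the truncated time shifted average sampling sum and $\sigma$ the associated bound on the averaging half-widths (both defined in the context). Then for every $t\in\mathbb R$ and all sufficiently large $N\in\mathbb N$, $$\mathsf E\big|\xi(t)-\mathcal A_{\mathbf u,N}(\xi;t)\big|^2\le \frac{2\widetilde L_0^2(t)}{N^2}\,\|F_\xi\|(\Lambda,\Lambda)+2\sigma^2\,\mathsf C_q(t)\,\sup_{x\in\mathbb R}|B''(x,x)|\cdot(2N+1)^{2/p}.$$ If $\sigma=\sigma_N=o(N^{-1/p})$ as $N\to\infty$, then $\lim_{N\to\infty}\mathcal A_{\mathbf u,N}(\xi;t)=\xi(t)$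 in mean square for every $t\in\mathbb R$. Moreover, if $\sigma=\sigma_N=\mathcal O(N^{-1/2-1/p-\varepsilon})$ for some $\varepsilon>0$, then for every $t\in\mathbb R$ $$\mathsf P\Big\{\lim_{N\to\infty}\mathcal A_{\mathbf u,N}(\xi;t)=\xi(t)\Big\}=1.$$
   Context: Piranashvili process: a centered second order (complex-valued) random process $\{\xi(t),t\in\mathbb R\}$ on a probability space $(\Omega,\mathfrak F,\mathsf P)$ whose covariance has the form $$B(t,s)=\mathsf E\,\xi(t)\xi^*(s)=\int_\Lambda\int_\Lambda f(t,\lambda)f^*(s,\mu)\,F_\xi(d\lambda,d\mu),$$ where $\Lambda\subseteq\mathbb R$ carries a sigma-algebra $\sigma(\Lambda)$, $^*$ is complex conjugation, and for each $\lambda\in\Lambda$ the kernel $f(\cdot,\lambda)$ extends to an entire function on $\mathbb C$ which is exponentially bounded: for some $M>0$, $\alpha\in\mathbb R$, $|f(t,\lambda)|\le Me^{\alpha|t|}$. $F_\xi$ is a positive definite measure on $\mathbb R^2$ with finite total variation $\|F_\xi\|(\Lambda,\Lambda)=\int_\Lambda\int_\Lambda|F_\xi(d\lambda,d\mu)|<\infty$. By the Karhunen–Cramér theorem, $\xi(t)=\int_\Lambda f(t,\lambda)\,Z_\xi(d\lambda)$, where $Z_\xi$ is a stochastic measure with $F_\xi(S_1,S_2)=\mathsf E Z_\xi(S_1)Z_\xi^*(S_2)$ for $S_1,S_2\in\sigma(\Lambda)$. Exponential type: $\gamma:=\sup_{\lambda\in\Lambda}\limsup_{n}\sqrt[n]{|f^{(n)}(0,\lambda)|}<\infty$,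 where $f^{(n)}(0,\lambda)$ is the $n$-th derivative in the first variable at $0$. $B''(t,t)$ denotes the mixed derivative $\frac{\partial^2B(x,y)}{\partial x\,\partial y}$ evaluated at $x=y=t$. Average sampling sums: for $t\in\mathbb R$, $N\in\mathbb N$ let $\mathbb I_N(t)=\{n\in\mathbb Z:|tw/\pi-n|\le N\}$ and $\mathfrak J_n(t)=\big[\frac{n\pi}w-\sigma_n'(t),\frac{n\pi}w+\sigma_n''(t)\big]$ with $0\le\sigma_n'(t),\sigma_n''(t)\le\frac{\pi}{2w}$. $\mathbf u=(u_n)_{n\in\mathbb Z}$ is a sequence of non-negative averaging functions, $u_n$ supported in $\mathfrak J_n(t)$, normalized by $\langle1,u_n\rangle_{\mathfrak J_n(t)}=1$, where $\langle g,u_n\rangle_{\mathfrak J_n(t)}=\int_{\mathfrak J_n(t)}g(x)u_n(x)\,dx$ (for $g=\xi$ a mean-square integral). Put $$\mathcal A_{\mathbf u,N}(\xi;t)=\sum_{n\in\mathbb I_N(t)}\langle\xi,u_n\rangle_{\mathfrak J_n(t)}\,\frac{\sin(wt-n\pi)}{wt-n\pi},\qquad \sigma=\sup_{t\in\mathbb R}\max_{n\in\mathbb I_N(t)}\max(\sigma_n'(t),\sigma_n''(t))<\infty,$$ with $\frac{\sin 0}{0}:=1$. The number $w$ is fixed; the averaging functions and intervals, hence $\sigma=\sigma_N$, may depend on $N$, and the asymptotic conditions on $\sigma$ are as $N\to\infty$. *)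

theory Defs
  imports "HOL-Probability.Probability" "HOL-Library.Landau_Symbols" "HOL-Library.Nonpos_Ints"
begin

subsection \<open>Complex measures\<close>

text \<open>
  A complex measure is a countably additive complex-valued function on the sigma-algebra of
  \<open>N\<close>; the (nonnegative) measure carried by \<open>N\<close> itself plays no role.
\<close>

definition complex_measure :: "'a measure \<Rightarrow> ('a set \<Rightarrow> complex) \<Rightarrow> bool" where
  "complex_measure N F \<longleftrightarrow> F {} = 0 \<and>
     (\<forall>A :: nat \<Rightarrow> 'a set. range A \<subseteq> sets N \<longrightarrow> disjoint_family A \<longrightarrow>
        (\<lambda>i. F (A i)) sums F (\<Union>i. A i))"

definition variation :: "'a measure \<Rightarrow> ('a set \<Rightarrow> complex) \<Rightarrow> 'a set \<Rightarrow> ennreal" where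
  "variation N F A =
     (SUP P \<in> {P. finite P \<and> disjoint P \<and> P \<subseteq> sets N \<and> \<Union>P = A}. \<Sum>S\<in>P. ennreal (cmod (F S)))"

definition variation_measure :: "'a measure \<Rightarrow> ('a set \<Rightarrow> complex) \<Rightarrow> 'a measure" where
  "variation_measure N F = measure_of (space N) (sets N) (variation N F)"

definition total_variation :: "'a measure \<Rightarrow> ('a set \<Rightarrow> complex) \<Rightarrow> real" where
  "total_variation N F = enn2real (variation N F (space N))"

text \<open>
  The positive part in the Jordan decomposition of a real measure \<open>G\<close>; the negative part is the
  positive part of \<open>-G\<close>.
\<close>

definition upper_variation_measure :: "'a measure \<Rightarrow> ('a set \<Rightarrow> real) \<Rightarrow> 'a measure" where
  "upper_variation_measure N G =
     measure_of (space N) (sets N) (\<lambda>A. SUP S \<in> {S \<in> sets N. S \<subseteq> A}. ennreal (G S))"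

definition complex_measure_integral ::
    "'a measure \<Rightarrow> ('a set \<Rightarrow> complex) \<Rightarrow> ('a \<Rightarrow> complex) \<Rightarrow> complex" where
  "complex_measure_integral N F g =
     ((LINT x|upper_variation_measure N (\<lambda>A. Re (F A)). g x)
       - (LINT x|upper_variation_measure N (\<lambda>A. - Re (F A)). g x))
     + \<i> * ((LINT x|upper_variation_measure N (\<lambda>A. Im (F A)). g x)
       - (LINT x|upper_variation_measure N (\<lambda>A. - Im (F A)). g x))"

definition positive_definite_measure :: "'b measure \<Rightarrow> (('b \<times> 'b) set \<Rightarrow> complex) \<Rightarrow> bool" where
  "positive_definite_measure L F \<longleftrightarrow>
     (\<forall>(m::nat) S c. (\<forall>j<m. S j \<in> sets L) \<longrightarrow>
        (\<Sum>j<m. \<Sum>k<m. c j * cnj (c k) * F (S j \<times> S k)) \<in> \<real>\<^sub>\<ge>\<^sub>0)"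


subsection \<open>Piranashvili processes\<close>

definition square_integrable :: "'a measure \<Rightarrow> ('a \<Rightarrow> complex) \<Rightarrow> bool" where
  "square_integrable M X \<longleftrightarrow>
     X \<in> borel_measurable M \<and> integrable M (\<lambda>\<omega>. (cmod (X \<omega>))\<^sup>2)"

definition covariance :: "'a measure \<Rightarrow> (real \<Rightarrow> 'a \<Rightarrow> complex) \<Rightarrow> real \<Rightarrow> real \<Rightarrow> complex" where
  "covariance M \<xi> t s = (LINT \<omega>|M. \<xi> t \<omega> * cnj (\<xi> s \<omega>))"

text \<open>
  The set \<open>\<Lambda>\<close> with its sigma-algebra is given by \<open>L\<close>, that is \<open>\<Lambda> = space L\<close>. The first argument
  of the kernel \<open>f\<close> is complex: \<open>f z l\<close> is the entire extension, and the process only involves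
  its values at real arguments.
\<close>

definition piranashvili_process ::
    "'a measure \<Rightarrow> real measure \<Rightarrow> (complex \<Rightarrow> real \<Rightarrow> complex) \<Rightarrow>
     ((real \<times> real) set \<Rightarrow> complex) \<Rightarrow> (real \<Rightarrow> 'a \<Rightarrow> complex) \<Rightarrow> bool" where
  "piranashvili_process M L f F \<xi> \<longleftrightarrow>
     prob_space M \<and>
     (\<forall>t. square_integrable M (\<xi> t) \<and> (LINT \<omega>|M. \<xi> t \<omega>) = 0) \<and>
     (\<forall>l\<in>space L. (\<lambda>z. f z l) holomorphic_on UNIV \<and>
        (\<exists>K>0. \<exists>\<alpha>::real. \<forall>z. cmod (f z l) \<le> K * exp (\<alpha> * cmod z))) \<and>
     (\<forall>t::real. f (of_real t) \<in> borel_measurable L) \<and>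
     complex_measure (L \<Otimes>\<^sub>M L) F \<and>
     positive_definite_measure L F \<and>
     variation (L \<Otimes>\<^sub>M L) F (space L \<times> space L) < \<infinity> \<and>
     (\<forall>t s.
        integrable (variation_measure (L \<Otimes>\<^sub>M L) F)
          (\<lambda>(l, m). f (of_real t) l * cnj (f (of_real s) m)) \<and>
        covariance M \<xi> t s =
          complex_measure_integral (L \<Otimes>\<^sub>M L) F
            (\<lambda>(l, m). f (of_real t) l * cnj (f (of_real s) m)))"

text \<open>For an empty parameter set this is \<open>-\<infinity>\<close>; otherwise it is nonnegative.\<close>

definition kernel_exponential_type :: "real measure \<Rightarrow> (complex \<Rightarrow> real \<Rightarrow> complex) \<Rightarrow> ereal" where
  "kernel_exponential_type L f =
     (SUP l\<in>space L. limsup (\<lambda>n. ereal (root n (cmod ((deriv ^^ n) (\<lambda>z. f z l) 0)))))"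

definition kernel_bound :: "real measure \<Rightarrow> (complex \<Rightarrow> real \<Rightarrow> complex) \<Rightarrow> real" where
  "kernel_bound L f = (SUP t::real. SUP l\<in>space L. cmod (f (of_real t) l))"


subsection \<open>Twice continuously differentiable functions on the plane\<close>

definition partial1 :: "(real \<Rightarrow> real \<Rightarrow> complex) \<Rightarrow> real \<Rightarrow> real \<Rightarrow> complex" where
  "partial1 g x y = vector_derivative (\<lambda>u. g u y) (at x)"

definition partial2 :: "(real \<Rightarrow> real \<Rightarrow> complex) \<Rightarrow> real \<Rightarrow> real \<Rightarrow> complex" where
  "partial2 g x y = vector_derivative (\<lambda>v. g x v) (at y)"

definition C1_plane :: "(real \<Rightarrow> real \<Rightarrow> complex) \<Rightarrow> bool" where
  "C1_plane g \<longleftrightarrow>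
     (\<forall>x y. (\<lambda>u. g u y) differentiable (at x) \<and> (\<lambda>v. g x v) differentiable (at y)) \<and>
     continuous_on UNIV (\<lambda>(x, y). partial1 g x y) \<and>
     continuous_on UNIV (\<lambda>(x, y). partial2 g x y)"

definition C2_plane :: "(real \<Rightarrow> real \<Rightarrow> complex) \<Rightarrow> bool" where
  "C2_plane g \<longleftrightarrow> C1_plane g \<and> C1_plane (partial1 g) \<and> C1_plane (partial2 g)"

definition mixed_deriv :: "(real \<Rightarrow> real \<Rightarrow> complex) \<Rightarrow> real \<Rightarrow> real \<Rightarrow> complex" where
  "mixed_deriv g = partial1 (partial2 g)"


subsection \<open>Average sampling sums\<close>

text \<open>
  \<open>Y\<close> is a version of the mean-square integral of the process \<open>X\<close> over the compact interval \<open>S\<close>: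
  the definition of \<^const>\<open>has_integral\<close> on such an interval, with convergence of the sums in the
  mean-square sense. This covers mean-square Riemann integrals, and also Bochner integrals in
  the Hilbert space of square-integrable random variables.
\<close>

definition has_ms_integral ::
    "'a measure \<Rightarrow> (real \<Rightarrow> 'a \<Rightarrow> complex) \<Rightarrow> ('a \<Rightarrow> complex) \<Rightarrow> real set \<Rightarrow> bool" where
  "has_ms_integral M X Y S \<longleftrightarrow> square_integrable M Y \<and>
     ((\<lambda>D. LINT \<omega>|M. (cmod ((\<Sum>(x, K)\<in>D. measure lborel K *\<^sub>R X x \<omega>) - Y \<omega>))\<^sup>2) \<longlongrightarrow> 0)
       (division_filter S)"

definition sampling_indices :: "real \<Rightarrow> nat \<Rightarrow> real \<Rightarrow> int set" where
  "sampling_indices w N t = {n. \<bar>t * w / pi - of_int n\<bar> \<le> real N}"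

definition averaging_window :: "real \<Rightarrow> (real \<Rightarrow> int \<Rightarrow> real) \<Rightarrow> (real \<Rightarrow> int \<Rightarrow> real) \<Rightarrow>
    real \<Rightarrow> int \<Rightarrow> real set" where
  "averaging_window w \<sigma>' \<sigma>'' t n = {of_int n * pi / w - \<sigma>' t n .. of_int n * pi / w + \<sigma>'' t n}"

definition averaging_functions :: "real \<Rightarrow> (real \<Rightarrow> int \<Rightarrow> real) \<Rightarrow> (real \<Rightarrow> int \<Rightarrow> real) \<Rightarrow>
    (real \<Rightarrow> int \<Rightarrow> real \<Rightarrow> real) \<Rightarrow> bool" where
  "averaging_functions w \<sigma>' \<sigma>'' u \<longleftrightarrow>
     (\<forall>t n. 0 \<le> \<sigma>' t n \<and> \<sigma>' t n \<le> pi / (2 * w) \<and> 0 \<le> \<sigma>'' t n \<and> \<sigma>'' t n \<le> pi / (2 * w) \<and>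
        (\<forall>x. 0 \<le> u t n x) \<and>
        (\<forall>x. x \<notin> averaging_window w \<sigma>' \<sigma>'' t n \<longrightarrow> u t n x = 0) \<and>
        (u t n has_integral 1) (averaging_window w \<sigma>' \<sigma>'' t n))"

text \<open>For \<open>N = 0\<close> the index set may be empty, so that this is only meaningful for \<open>N \<ge> 1\<close>.\<close>

definition averaging_width :: "real \<Rightarrow> nat \<Rightarrow> (real \<Rightarrow> int \<Rightarrow> real) \<Rightarrow> (real \<Rightarrow> int \<Rightarrow> real) \<Rightarrow> real" where
  "averaging_width w N \<sigma>' \<sigma>'' =
     (SUP t. MAX n\<in>sampling_indices w N t. max (\<sigma>' t n) (\<sigma>'' t n))"

text \<open>\<open>Y t n\<close> are the random averages around the nodes \<open>n * pi / w\<close>.\<close>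

definition average_sampling_sum ::
    "real \<Rightarrow> nat \<Rightarrow> (real \<Rightarrow> int \<Rightarrow> 'a \<Rightarrow> complex) \<Rightarrow> real \<Rightarrow> 'a \<Rightarrow> complex" where
  "average_sampling_sum w N Y t \<omega> =
     (\<Sum>n\<in>sampling_indices w N t. Y t n \<omega> * of_real (sinc (w * t - of_int n * pi)))"


subsection \<open>Constants in the error bound\<close>

definition truncation_const :: "real \<Rightarrow> real \<Rightarrow> real \<Rightarrow> real \<Rightarrow> real" where
  "truncation_const Lf w \<gamma> t =
     4 * Lf * w * \<bar>sin (w * t)\<bar> / (pi * (w - \<gamma>) * (1 - exp (- pi)))"

definition odd_zeta :: "real \<Rightarrow> real" where
  "odd_zeta q = (\<Sum>n. 1 / (2 * real (Suc n) - 1) powr q)"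

definition averaging_const :: "real \<Rightarrow> real \<Rightarrow> real \<Rightarrow> real" where
  "averaging_const w q t =
     (1 + 2 powr (q + 1) * \<bar>sin (w * t)\<bar> powr q / pi powr q * odd_zeta q) powr (2 / q)"

end

theory Submission
  imports Defs "HOL-Complex_Analysis.Complex_Analysis" "HOL-Real_Asymp.Real_Asymp"
begin

text \<open>
  The error splits at the ordinary truncated sampling sum
  \<open>S N = (\<Sum>n. \<xi> (n * pi / w) * sinc (w * t - n * pi))\<close>, and
  \<open>\<bar>x + y\<bar>\<^sup>2 \<le> 2 * \<bar>x\<bar>\<^sup>2 + 2 * \<bar>y\<bar>\<^sup>2\<close> accounts for the two factors \<open>2\<close> in the bound.

  For the truncation error \<open>\<xi> t - S N\<close>, the covariance representation turns the second moment of
  a linear combination of values of \<open>\<xi>\<close> into the integral against \<open>F\<close> of the product of the same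
  combination of kernel functions with its conjugate; hence it is at most the squared supremum of
  that combination times the total variation of \<open>F\<close> (\<open>piranashvili_second_moment_le\<close>). It remains
  to bound the truncation error of a single entire function \<open>g\<close> of exponential type at most
  \<open>\<gamma> < w\<close>, bounded by \<open>K\<close> on the real line. By Phragmen and Lindeloef,
  \<open>\<bar>g z\<bar> \<le> K' * exp (a * \<bar>Im z\<bar>)\<close> for all \<open>a > \<gamma>\<close> and \<open>K' > K\<close>
  (\<open>exponential_type_bounded_on_real_line\<close>). The
  residues of \<open>g x / ((x - t) * sin (w * x))\<close> at \<open>t\<close> and at the nodes in the index set add up to the
  truncation error divided by \<open>sin (w * t)\<close>. So the error is a contour integral over a rectangle
  whose vertical sides pass halfway between two nodes, at distance at least \<open>N * pi / (2 * w)\<close>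
  from \<open>t\<close>. There \<open>\<bar>sin (w * x)\<bar>\<close> is at least \<open>exp (w * \<bar>Im x\<bar>) / 2\<close>, which gives the
  rate \<open>1 / N\<close>, and the horizontal sides contribute nothing in the limit of infinite height
  (\<open>sampling_truncation_error\<close>).

  For the averaging error \<open>S N - \<A> N t\<close>, the second moment of an increment is a mixed second
  difference of \<open>B\<close>, so that \<open>\<xi>\<close> is Lipschitz in mean square with squared constant
  \<open>D = (SUP x. \<bar>B'' x x\<bar>)\<close> (\<open>mean_square_Lipschitz\<close>). A weighted average of \<open>\<xi>\<close>
  over points within \<open>\<sigma>\<close> of a node therefore has mean-square distance at most
  \<open>sqrt D * \<sigma>\<close> from the value at the node (\<open>mean_square_average_error\<close>).
  Weighting these errors by the sinc values multiplies the second moment by at most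
  the square of the sum of their absolute values, which Hoelder's inequality and a comparison with
  the odd integers bound by \<open>averaging_const w q t * (2 * N + 1) powr (2 / p)\<close>
  (\<open>sum_abs_sinc_power2_le\<close>).

  Both bounds hold for all \<open>N \<ge> 1\<close>. If \<open>\<sigma> N = o (N powr (- 1 / p))\<close>, they tend to \<open>0\<close>. If
  \<open>\<sigma> N = O (N powr (- 1 / 2 - 1 / p - \<epsilon>))\<close>, they are \<open>O (1 / N\<^sup>2 + N powr (- 1 - 2 * \<epsilon>))\<close>, hence
  summable, and then almost sure convergence follows from monotone convergence
  (\<open>AE_tendsto_0_if_summable_second_moments\<close>).
\<close>

section \<open>Entire functions of exponential type\<close>

text \<open>
  Several bounds below carry a free parameter \<open>e > 0\<close> and are sharpened by letting \<open>e\<close> tend to \<open>0\<close>.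
\<close>

lemma le_limit_at_right_0:
  fixes x y :: real
  assumes "(\<phi> \<longlongrightarrow> y) (at_right (0 :: real))" "\<And>e. e > 0 \<Longrightarrow> x \<le> \<phi> e"
  shows "x \<le> y"
proof (rule tendsto_lowerbound[OF assms(1)])
  show "\<forall>\<^sub>F e in at_right 0. x \<le> \<phi> e"
    using eventually_at_right_less[of 0] by (rule eventually_mono) (rule assms(2))
qed simp

text \<open>
  The part of \<open>S\<close> in a large disc is bounded, and its boundary lies on that of \<open>S\<close> or on the circle,
  where the bound \<open>far\<close> applies. All Phragmen-Lindeloef arguments below reduce to this form by a
  damping factor.
\<close>

lemma maximum_modulus_unbounded:
  assumes "closed S" "f holomorphic_on S"
    and front: "\<And>z. z \<in> frontier S \<Longrightarrow> norm (f z) \<le> B"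
    and far: "\<And>z. z \<in> S \<Longrightarrow> norm z \<ge> R \<Longrightarrow> norm (f z) \<le> B"
    and "z \<in> S"
  shows "norm (f z) \<le> B"
proof -
  define T where "T = S \<inter> cball 0 (max R (norm z))"
  have clT: "closed T" unfolding T_def using assms(1) by auto
  show ?thesis
  proof (rule maximum_modulus_frontier[where S = T and f = f and \<xi> = z])
    show "f holomorphic_on interior T"
      using interior_subset[of T] by (intro holomorphic_on_subset[OF assms(2)]) (auto simp: T_def)
    show "continuous_on (closure T) f"
      by (rule continuous_on_subset[OF holomorphic_on_imp_continuous_on[OF assms(2)]])
         (simp add: closure_closed[OF clT], simp add: T_def)
    show "bounded T" unfolding T_def by (simp add: bounded_Int)
    show "z \<in> T" unfolding T_def using assms(5) by auto
    show "norm (f y) \<le> B" if y: "y \<in> frontier T" for y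
    proof -
      have "y \<in> T" using y clT frontier_subset_closed by blast
      have "y \<in> frontier S \<union> frontier (cball 0 (max R (norm z)))"
        using y frontier_Int_subset[of S "cball 0 (max R (norm z))"] unfolding T_def by auto
      then show ?thesis
        using front[of y] far[of y] \<open>y \<in> T\<close> by (auto simp: T_def frontier_cball)
    qed
  qed
qed

text \<open>
  If \<open>z = s\<^sup>2\<close>, then \<open>Re (s ^ 3) = Re s * (2 * Re z - \<bar>z\<bar>)\<close>. So \<open>z powr (3 / 2)\<close> has a
  real part comparable to its modulus on the sector of opening \<open>pi / 2\<close>; this is what makes
  \<open>exp (- e * z powr (3 / 2))\<close> a damping factor there.
\<close>

lemma Re_csqrt_cube_lower:
  assumes "\<bar>Im z\<bar> \<le> Re z"
  shows "Re (csqrt z ^ 3) \<ge> norm z * sqrt (norm z) / 8"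
proof -
  define s where "s = csqrt z"
  have s2: "s\<^sup>2 = z" by (simp add: s_def)
  have nz: "norm z \<le> 3/2 * Re z"
  proof (rule power2_le_imp_le)
    have "(Im z)\<^sup>2 \<le> (Re z)\<^sup>2" using assms by (metis abs_le_square_iff abs_of_nonneg abs_ge_zero order_trans)
    moreover have "0 \<le> (Re z)\<^sup>2" and "(3/2 * Re z)\<^sup>2 = 9/4 * (Re z)\<^sup>2"
      by (simp_all add: power_mult_distrib power_divide)
    ultimately show "(norm z)\<^sup>2 \<le> (3/2 * Re z)\<^sup>2"
      using cmod_power2[of z] by linarith
    show "0 \<le> 3/2 * Re z" using assms by linarith
  qed
  have ns: "norm z = (Re s)\<^sup>2 + (Im s)\<^sup>2" using s2 by (metis cmod_power2 norm_power)
  have rz: "Re z = (Re s)\<^sup>2 - (Im s)\<^sup>2" using s2 by (metis Re_power2)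
  have pos: "0 \<le> Re s" unfolding s_def using csqrt_principal[of z] by linarith
  have "Re (s ^ 3) = Re s * ((Re s)\<^sup>2 - 3 * (Im s)\<^sup>2)"
    by (simp add: power3_eq_cube power2_eq_square algebra_simps)
  also have "(Re s)\<^sup>2 - 3 * (Im s)\<^sup>2 = 2 * Re z - norm z" using ns rz by simp
  finally have eq: "Re (s^3) = Re s * (2 * Re z - norm z)" .
  have "sqrt (norm z) / 2 \<le> Re s"
  proof (rule power2_le_imp_le)
    have "0 \<le> Re z" using assms by linarith
    moreover have "(sqrt (norm z) / 2)\<^sup>2 = norm z / 4" by (simp add: power_divide)
    ultimately show "(sqrt (norm z) / 2)\<^sup>2 \<le> (Re s)\<^sup>2"
      using ns rz zero_le_power2[of "Re s"] by linarith
  qed (rule pos)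
  moreover have "norm z / 4 \<le> 2 * Re z - norm z" using nz norm_ge_zero[of z] by linarith
  ultimately have "sqrt (norm z) / 2 * (norm z / 4) \<le> Re s * (2 * Re z - norm z)"
    by (intro mult_mono) (use pos in auto)
  then show ?thesis using eq by (simp add: s_def mult.commute)
qed

text \<open>
  The factor \<open>exp (- e * z powr (3 / 2))\<close> has modulus at most \<open>1\<close> on the sector and beats growth
  of order one, because \<open>3 / 2 > 1\<close>.
\<close>

lemma phragmen_lindelof_sector:
  assumes hol: "f holomorphic_on UNIV" and "B > 0"
    and growth: "\<And>z. norm (f z) \<le> C * exp (a * norm z)"
    and bd: "\<And>z. \<bar>Im z\<bar> = Re z \<Longrightarrow> norm (f z) \<le> B"
    and z: "\<bar>Im z\<bar> \<le> Re z"
  shows "norm (f z) \<le> B"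
proof -
  define S where "S = {z. \<bar>Im z\<bar> \<le> Re z}"
  have clS: "closed S" unfolding S_def
    by (intro closed_Collect_le continuous_intros)
  have oS: "open {z. \<bar>Im z\<bar> < Re z}"
    by (intro open_Collect_less continuous_intros)
  have frS: "\<bar>Im y\<bar> = Re y" if "y \<in> frontier S" for y
  proof -
    have "y \<in> S" using that clS frontier_subset_closed by blast
    moreover have "y \<notin> {z. \<bar>Im z\<bar> < Re z}"
      using that interior_maximal[of "{z. \<bar>Im z\<bar> < Re z}" S] oS
      unfolding frontier_def S_def by fastforce
    ultimately show ?thesis by (auto simp: S_def)
  qed
  \<comment> \<open>The shift by \<open>1\<close> moves the branch point of the square root out of the sector.\<close>
  define s where "s = (\<lambda>z. csqrt (z + 1) ^ 3)"
  have nonpos: "z + 1 \<notin> \<real>\<^sub>\<le>\<^sub>0" if "z \<in> S" for z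
    using that by (auto simp: S_def complex_nonpos_Reals_iff)
  have sw: "Re (s z) \<ge> norm z * sqrt (norm z) / 8" if "z \<in> S" for z
  proof -
    have "\<bar>Im (z+1)\<bar> \<le> Re (z+1)" using that by (auto simp: S_def)
    from Re_csqrt_cube_lower[OF this]
    have "Re (s z) \<ge> norm (z+1) * sqrt (norm (z+1)) / 8" by (simp add: s_def)
    moreover have "norm z \<le> norm (z+1)"
      using that by (auto simp: S_def cmod_def power2_eq_square algebra_simps)
    then have "norm z * sqrt (norm z) \<le> norm (z+1) * sqrt (norm (z+1))"
      by (intro mult_mono) auto
    ultimately show ?thesis by linarith
  qed
  have spos: "Re (s z) \<ge> 0" if "z \<in> S" for z
    using sw[OF that] by (meson divide_nonneg_nonneg mult_nonneg_nonneg norm_ge_zero order_trans real_sqrt_ge_zero zero_le_numeral)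
  have main: "norm (f z) \<le> B * exp (e * Re (s z))" if "e > 0" for e :: real
  proof -
    define h where "h = (\<lambda>z. f z * exp (- (of_real e * s z)))"
    have nh: "norm (h z) = norm (f z) * exp (- (e * Re (s z)))" for z
      by (simp add: h_def norm_mult)
    have lim: "((\<lambda>r::real. C * exp (a * r - e * (r * sqrt r / 8))) \<longlongrightarrow> 0) at_top"
      using \<open>e > 0\<close> by real_asymp
    have "eventually (\<lambda>r. C * exp (a * r - e * (r * sqrt r / 8)) < B) at_top"
      by (rule order_tendstoD(2)[OF lim \<open>B > 0\<close>])
    then obtain R where R: "\<And>r. r \<ge> R \<Longrightarrow> C * exp (a * r - e * (r * sqrt r / 8)) < B"
      by (auto simp: eventually_at_top_linorder)
    have "norm (h z) \<le> B"
    proof (rule maximum_modulus_unbounded[OF clS, where f = h and z = z and R = R])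
      have "f holomorphic_on S" using hol holomorphic_on_subset by blast
      then show "h holomorphic_on S" unfolding h_def s_def
        by (intro holomorphic_intros) (use nonpos in auto)
      show "z \<in> S" using z by (simp add: S_def)
      show "norm (h y) \<le> B" if "y \<in> frontier S" for y
      proof -
        have "y \<in> S" using that clS frontier_subset_closed by blast
        then have "exp (- (e * Re (s y))) \<le> 1" using spos \<open>e > 0\<close> by simp
        then have "norm (h y) \<le> norm (f y)"
          unfolding nh by (simp add: mult_left_le)
        then show ?thesis using bd[OF frS[OF that]] by simp
      qed
      show "norm (h y) \<le> B" if "y \<in> S" "norm y \<ge> R" for y
      proof -
        have "e * (norm y * sqrt (norm y) / 8) \<le> e * Re (s y)"
          using sw[OF that(1)] \<open>e > 0\<close> by (intro mult_left_mono) auto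
        then have "exp (- (e * Re (s y))) \<le> exp (- (e * (norm y * sqrt (norm y) / 8)))" by simp
        then have "norm (h y) \<le> C * exp (a * norm y) * exp (- (e * (norm y * sqrt (norm y) / 8)))"
          unfolding nh using growth[of y]
          by (intro mult_mono) (auto intro: order_trans[OF norm_ge_zero])
        also have "\<dots> = C * exp (a * norm y - e * (norm y * sqrt (norm y) / 8))"
          by (simp add: mult.assoc mult_exp_exp)
        also have "\<dots> \<le> B" using R[OF that(2)] by simp
        finally show ?thesis .
      qed
    qed
    then show ?thesis unfolding nh by (simp add: exp_minus field_simps)
  qed
  have "((\<lambda>e. B * exp (e * Re (s z))) \<longlongrightarrow> B * exp (0 * Re (s z))) (at_right 0)"
    by (intro tendsto_intros)
  then have "((\<lambda>e. B * exp (e * Re (s z))) \<longlongrightarrow> B) (at_right 0)" by simp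
  then show ?thesis
    by (rule le_limit_at_right_0) (rule main)
qed

text \<open>
  Each of the two quadrants of the upper half plane is a rotated copy of the sector.
\<close>

lemma phragmen_lindelof_quadrants:
  assumes hol: "f holomorphic_on UNIV" and "B > 0" "0 \<le> a"
    and growth: "\<And>z. norm (f z) \<le> C * exp (a * norm z)"
    and bdr: "\<And>x. norm (f (of_real x)) \<le> B"
    and bdi: "\<And>y. y \<ge> 0 \<Longrightarrow> norm (f (Complex 0 y)) \<le> B"
    and "Im z \<ge> 0"
  shows "norm (f z) \<le> B"
proof -
  have C0: "C \<ge> 0" using order_trans[OF norm_ge_zero growth[of 0]] by simp
  have main: "norm (f (c * \<zeta>)) \<le> B" if c: "c = Complex 1 1 \<or> c = Complex (-1) 1" and "\<bar>Im \<zeta>\<bar> \<le> Re \<zeta>" for c \<zeta>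
  proof (rule phragmen_lindelof_sector[where f = "\<lambda>z. f (c * z)" and C=C and a="2*a"])
    show "(\<lambda>z. f (c * z)) holomorphic_on UNIV"
      using holomorphic_on_compose_gen[of "\<lambda>z. c * z" UNIV f UNIV] hol
      by (auto simp: o_def intro: holomorphic_intros)
    have nc: "norm c \<le> 2" using c cmod_le[of c] by auto
    show "norm (f (c * z)) \<le> C * exp (2 * a * norm z)" for z
    proof -
      have "a * norm (c * z) \<le> 2 * a * norm z"
        using mult_left_mono[OF mult_right_mono[OF nc norm_ge_zero[of z]] \<open>a \<ge> 0\<close>]
        by (simp add: norm_mult mult_ac)
      then have "C * exp (a * norm (c * z)) \<le> C * exp (2 * a * norm z)"
        using C0 by (intro mult_left_mono) auto
      then show ?thesis using growth[of "c*z"] by linarith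
    qed
    show "norm (f (c * z)) \<le> B" if "\<bar>Im z\<bar> = Re z" for z
    proof -
      obtain x y where zc: "z = Complex x y" by (cases z)
      have "(\<exists>r. c * z = of_real r) \<or> (\<exists>r\<ge>0. c * z = Complex 0 r)"
        using c that by (auto simp: zc complex_eq_iff abs_if split: if_splits)
      then show ?thesis using bdr bdi by auto
    qed
  qed fact+
  show ?thesis
  proof (cases "Re z \<ge> 0")
    case True
    have "z = Complex 1 1 * Complex ((Re z + Im z)/2) ((Im z - Re z)/2)"
      by (simp add: complex_eq_iff field_simps)
    moreover have "norm (f (Complex 1 1 * Complex ((Re z + Im z)/2) ((Im z - Re z)/2))) \<le> B"
      by (rule main) (use True assms(7) in \<open>auto simp: abs_le_iff\<close>)
    ultimately show ?thesis by metis
  next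
    case False
    have "z = Complex (-1) 1 * Complex ((Im z - Re z)/2) (- (Re z + Im z)/2)"
      by (simp add: complex_eq_iff field_simps)
    moreover have "norm (f (Complex (-1) 1 * Complex ((Im z - Re z)/2) (- (Re z + Im z)/2))) \<le> B"
      by (rule main) (use False assms(7) in \<open>auto simp: abs_le_iff\<close>)
    ultimately show ?thesis by metis
  qed
qed

text \<open>
  An arbitrary bound \<open>K\<close> on the half plane improves to the bound on the boundary: dividing by
  \<open>1 - \<i> * e * z\<close>, whose modulus there is at least \<open>1\<close> and grows without bound, makes the
  maximum principle applicable.
\<close>

lemma phragmen_lindelof_half_plane:
  assumes hol: "f holomorphic_on UNIV" and "L > 0"
    and bdd: "\<And>z. Im z \<ge> 0 \<Longrightarrow> norm (f z) \<le> K"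
    and bdr: "\<And>x. norm (f (of_real x)) \<le> L"
    and z: "Im z \<ge> 0"
  shows "norm (f z) \<le> L"
proof -
  have clS: "closed {z. Im z \<ge> 0}" by (intro closed_Collect_le continuous_intros)
  have main: "norm (f z) \<le> L * norm (1 - \<i> * of_real e * z)" if "e > 0" for e :: real
  proof -
    define d where "d = (\<lambda>z. 1 - \<i> * of_real e * z)"
    have Re_d: "Re (d y) = 1 + e * Im y" "Im (d y) = - (e * Re y)" for y by (auto simp: d_def)
    have d1: "norm (d y) \<ge> 1" if "Im y \<ge> 0" for y
      using complex_Re_le_cmod[of "d y"] Re_d[of y] that \<open>e > 0\<close> mult_nonneg_nonneg[of e "Im y"] by linarith
    have d2: "norm (d y) \<ge> e * norm y" if "Im y \<ge> 0" for y
    proof (rule power2_le_imp_le)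
      have "0 \<le> 2 * e * Im y" using that \<open>e > 0\<close> by simp
      then show "(e * norm y)\<^sup>2 \<le> (norm (d y))\<^sup>2"
        unfolding power_mult_distrib cmod_power2 Re_d by (simp add: power2_eq_square algebra_simps)
    qed simp
    have "norm (f z / d z) \<le> L"
    proof (rule maximum_modulus_unbounded[OF clS, where f = "\<lambda>z. f z / d z" and z = z and R = "K / (L * e)"])
      have nz: "d y \<noteq> 0" if "Im y \<ge> 0" for y using d1[OF that] by auto
      have "f holomorphic_on {z. Im z \<ge> 0}" using hol holomorphic_on_subset by blast
      moreover have "d holomorphic_on {z. Im z \<ge> 0}" unfolding d_def by (intro holomorphic_intros)
      ultimately show "(\<lambda>z. f z / d z) holomorphic_on {z. 0 \<le> Im z}"
        by (intro holomorphic_intros) (use nz in auto)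
      show "norm (f y / d y) \<le> L" if "y \<in> frontier {z. 0 \<le> Im z}" for y
      proof -
        have 1: "y \<in> {z. 0 \<le> Im z}" using that clS frontier_subset_closed by blast
        have "open {z. Im z > 0}" by (intro open_Collect_less continuous_intros)
        then have "y \<notin> {z. Im z > 0}"
          using that interior_maximal[of "{z. Im z > 0}" "{z. Im z \<ge> 0}"] unfolding frontier_def by fastforce
        with 1 have "y = of_real (Re y)" by (auto simp: complex_eq_iff)
        then have "norm (f y) \<le> L" using bdr by metis
        also have "L \<le> L * norm (d y)" using d1[of y] 1 \<open>L > 0\<close> by simp
        finally show ?thesis using d1[of y] 1 \<open>L > 0\<close> by (simp add: norm_divide divide_le_eq)
      qed
      show "norm (f y / d y) \<le> L" if "y \<in> {z. 0 \<le> Im z}" "K / (L * e) \<le> norm y" for y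
      proof -
        have "K \<le> L * (e * norm y)" using that(2) \<open>L > 0\<close> \<open>e > 0\<close> by (simp add: field_simps)
        also have "\<dots> \<le> L * norm (d y)" using d2[of y] that(1) \<open>L > 0\<close> by (intro mult_left_mono) auto
        finally have "norm (f y) \<le> L * norm (d y)" using bdd[of y] that(1) by auto
        then show ?thesis using d1[of y] that(1) \<open>L > 0\<close> by (simp add: norm_divide divide_le_eq)
      qed
      show "z \<in> {z. 0 \<le> Im z}" using z by simp
    qed
    moreover have "norm (d z) > 0" using d1[of z] z by linarith
    ultimately have "norm (f z) \<le> L * norm (d z)" by (simp add: norm_divide divide_le_eq)
    then show ?thesis unfolding d_def .
  qed
  have "((\<lambda>e. L * norm (1 - \<i> * of_real e * z)) \<longlongrightarrow> L * norm (1 - \<i> * of_real 0 * z)) (at_right 0)"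
    by (intro tendsto_intros)
  then have "((\<lambda>e. L * norm (1 - \<i> * of_real e * z)) \<longlongrightarrow> L) (at_right 0)" by simp
  then show ?thesis
    by (rule le_limit_at_right_0) (rule main)
qed

text \<open>
  In the upper half plane, \<open>f z * exp (\<i> * a * z)\<close> is bounded by \<open>C\<close> on the positive imaginary axis and by
  \<open>L\<close> on the real axis; the quadrant version gives a bound by the larger of the two and the
  half-plane version removes \<open>C\<close>. The lower half plane follows by \<open>z \<mapsto> - z\<close>.
\<close>

lemma exponential_type_bounded_on_real_line:
  assumes hol: "f holomorphic_on UNIV" and "L > 0" "0 \<le> a"
    and growth: "\<And>z. norm (f z) \<le> C * exp (a * norm z)"
    and bdr: "\<And>x. norm (f (of_real x)) \<le> L"
  shows "norm (f z) \<le> L * exp (a * \<bar>Im z\<bar>)"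
proof -
  have upper: "norm (g z) \<le> L * exp (a * Im z)"
    if holg: "g holomorphic_on UNIV" and growthg: "\<And>z. norm (g z) \<le> C * exp (a * norm z)"
      and bdg: "\<And>x. norm (g (of_real x)) \<le> L" and z: "Im z \<ge> 0" for g z
  proof -
    define h where "h = (\<lambda>z. g z * exp (\<i> * of_real a * z))"
    have nh: "norm (h z) = norm (g z) * exp (- (a * Im z))" for z
      by (simp add: h_def norm_mult)
    have holh: "h holomorphic_on UNIV" unfolding h_def by (intro holomorphic_intros holg)
    have C0: "C \<ge> 0" using order_trans[OF norm_ge_zero growth[of 0]] by simp
    have hr: "norm (h (of_real x)) \<le> L" for x using bdg[of x] by (simp add: nh)
    have "norm (h y) \<le> max L C" if "Im y \<ge> 0" for y
    proof (rule phragmen_lindelof_quadrants[OF holh, where C = C and a = "2*a"])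
      show "norm (h z) \<le> C * exp (2 * a * norm z)" for z
      proof -
        have "- (a * Im z) \<le> a * norm z"
          using abs_Im_le_cmod[of z] \<open>0 \<le> a\<close> by (metis abs_le_D2 mult_left_mono mult_minus_right order_trans)
        then have "norm (h z) \<le> C * exp (a * norm z) * exp (a * norm z)"
          unfolding nh using growthg[of z] C0 by (intro mult_mono) auto
        then show ?thesis by (simp add: mult.assoc mult_exp_exp)
      qed
      show "norm (h (Complex 0 y)) \<le> max L C" if "y \<ge> 0" for y
      proof -
        have "norm (h (Complex 0 y)) \<le> C * exp (a * y) * exp (- (a * y))"
          using growthg[of "Complex 0 y"] that unfolding nh by (simp add: cmod_def)
        then show ?thesis by (simp add: mult.assoc mult_exp_exp)
      qed
    qed (use \<open>L > 0\<close> \<open>0 \<le> a\<close> hr that in \<open>auto simp: le_max_iff_disj\<close>)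
    then have "norm (h z) \<le> L"
      by (rule phragmen_lindelof_half_plane[OF holh \<open>L > 0\<close> _ hr z])
    then show ?thesis unfolding nh by (simp add: exp_minus field_simps)
  qed
  show ?thesis
  proof (cases "Im z \<ge> 0")
    case True
    then show ?thesis using upper[OF hol growth bdr] by auto
  next
    case False
    have holm: "(\<lambda>z. f (- z)) holomorphic_on UNIV"
      using holomorphic_on_compose_gen[OF holomorphic_on_minus[OF holomorphic_on_ident[of UNIV]], of f UNIV] hol
      by (simp add: o_def)
    have "norm (f (- (- z))) \<le> L * exp (a * Im (- z))"
    proof (rule upper[OF holm])
      show "norm (f (- z)) \<le> C * exp (a * norm z)" for z using growth[of "-z"] by simp
      show "norm (f (- of_real x)) \<le> L" for x using bdr[of "-x"] by simp
    qed (use False in auto)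
    then show ?thesis using False by simp
  qed
qed

text \<open>
  All but finitely many Taylor coefficients are dominated by those of \<open>exp (a * z)\<close>; the constant
  \<open>C\<close> pays for the remaining ones.
\<close>

lemma exponential_growth_of_derivatives_at_0:
  assumes hol: "f holomorphic_on UNIV" and "0 \<le> a"
    and ls: "limsup (\<lambda>n. ereal (root n (norm ((deriv ^^ n) f 0)))) < ereal a"
  obtains C where "\<And>z. norm (f z) \<le> C * exp (a * norm z)"
proof -
  define c where "c = (\<lambda>n. norm ((deriv ^^ n) f 0))"
  have "eventually (\<lambda>n. root n (c n) < a) sequentially"
    using Limsup_lessD[OF ls] by (simp add: c_def)
  then obtain n0 where n0: "\<And>n. n \<ge> n0 \<Longrightarrow> root n (c n) < a" by (auto simp: eventually_sequentially)
  have le: "c n \<le> a ^ n" if "n \<ge> n0" "n > 0" for n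
  proof -
    have "c n = root n (c n) ^ n" using that by (simp add: c_def)
    also have "\<dots> \<le> a ^ n" using n0[OF that(1)] that by (intro power_mono) (auto simp: c_def)
    finally show ?thesis .
  qed
  define C where "C = 1 + (\<Sum>n<Suc n0. c n / a ^ n)"
  have a0: "a > 0 " 
    using n0[of n0] real_root_ge_zero[of "c n0" n0] by (simp add: c_def)
  have Cb: "c n \<le> C * a ^ n" for n
  proof (cases "n < Suc n0")
    case True
    have "c n / a ^ n \<le> (\<Sum>n<Suc n0. c n / a ^ n)"
      using True a0 by (intro member_le_sum) (auto simp: c_def)
    then have "c n / a ^ n \<le> C" by (simp add: C_def)
    then show ?thesis using a0 by (simp add: divide_le_eq)
  next
    case False
    have "(\<Sum>n<Suc n0. c n / a ^ n) \<ge> 0" using a0 by (intro sum_nonneg) (auto simp: c_def)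
    then have "a ^ n \<le> C * a ^ n" using a0 by (simp add: C_def)
    then show ?thesis using le[of n] False by linarith
  qed
  have "norm (f z) \<le> C * exp (a * norm z)" for z
  proof -
    have "f holomorphic_on ball 0 (norm z + 1)" using hol holomorphic_on_subset by blast
    from holomorphic_power_series[OF this, of z]
    have 1: "(\<lambda>n. (deriv ^^ n) f 0 / fact n * z ^ n) sums f z" by simp
    have 2: "(\<lambda>n. C * ((a * norm z) ^ n /\<^sub>R fact n)) sums (C * exp (a * norm z))"
      by (intro sums_mult exp_converges)
    have "norm ((deriv ^^ n) f 0 / fact n * z ^ n) \<le> C * ((a * norm z) ^ n /\<^sub>R fact n)" for n
      using Cb[of n] by (simp add: norm_mult norm_divide norm_power c_def power_mult_distrib divide_simps mult_right_mono mult.assoc[symmetric])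
    from norm_suminf_le[OF this] show ?thesis
      using sums_unique[OF 1] sums_unique[OF 2] sums_summable[OF 2] by simp
  qed
  then show ?thesis using that by blast
qed

section \<open>The truncated sampling series of one kernel function\<close>

lemma integral_exp_abs_le:
  assumes "c > (0::real)" "Y \<ge> 0"
  shows "(\<lambda>y. exp (- c * \<bar>y\<bar>)) integrable_on {-Y..Y}"
    and "integral {-Y..Y} (\<lambda>y. exp (- c * \<bar>y\<bar>)) \<le> 2 / c"
proof -
  have d1: "((\<lambda>y. - exp (- c * y) / c) has_real_derivative exp (- c * y)) (at y within S)" for y S
    by (rule derivative_eq_intros refl)+ (use assms(1) in \<open>simp_all add: field_simps\<close>)
  have d2: "((\<lambda>y. exp (c * y) / c) has_real_derivative exp (c * y)) (at y within S)" for y S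
    by (rule derivative_eq_intros refl)+ (use assms(1) in \<open>simp_all add: field_simps\<close>)
  have "((\<lambda>y. exp (- c * y)) has_integral (- exp (- c * Y) / c - (- exp (- c * 0) / c))) {0..Y}"
    by (rule fundamental_theorem_of_calculus[where f = "\<lambda>y. - exp (- c * y) / c"])
       (use assms d1 in \<open>simp_all add: has_real_derivative_iff_has_vector_derivative\<close>)
  then have 1: "((\<lambda>y. exp (- c * y)) has_integral (1 / c - exp (- c * Y) / c)) {0..Y}" by simp
  have "((\<lambda>y. exp (c * y)) has_integral (exp (c * 0) / c - exp (c * (-Y)) / c)) {-Y..0}"
    by (rule fundamental_theorem_of_calculus[where f = "\<lambda>y. exp (c * y) / c"])
       (use assms d2 in \<open>simp_all add: has_real_derivative_iff_has_vector_derivative\<close>)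
  then have 2: "((\<lambda>y. exp (c * y)) has_integral (1 / c - exp (- c * Y) / c)) {-Y..0}" by simp
  have a1: "((\<lambda>y. exp (- c * \<bar>y\<bar>)) has_integral (1 / c - exp (- c * Y) / c)) {0..Y}"
    by (rule has_integral_eq[rotated], rule 1) auto
  have a2: "((\<lambda>y. exp (- c * \<bar>y\<bar>)) has_integral (1 / c - exp (- c * Y) / c)) {-Y..0}"
    by (rule has_integral_eq[rotated], rule 2) auto
  have 3: "((\<lambda>y. exp (- c * \<bar>y\<bar>)) has_integral ((1 / c - exp (- c * Y) / c) + (1 / c - exp (- c * Y) / c))) {-Y..Y}"
    by (rule has_integral_combine[OF _ _ a2 a1]) (use assms in auto)
  show "(\<lambda>y. exp (- c * \<bar>y\<bar>)) integrable_on {-Y..Y}" using 3 by blast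
  have "exp (- c * Y) / c \<ge> 0" using assms by simp
  then show "integral {-Y..Y} (\<lambda>y. exp (- c * \<bar>y\<bar>)) \<le> 2 / c"
    unfolding integral_unique[OF 3] by linarith
qed

text \<open>
  On the vertical lines through the zeros of the cosine, \<open>\<bar>sin z\<bar> = cosh (Im z)\<close>.
\<close>

lemma norm_sin_ge_vertical:
  assumes "cos (Re z) = 0"
  shows "norm (sin z) \<ge> exp \<bar>Im z\<bar> / 2"
proof -
  have "\<bar>sin (Re z)\<bar> = 1"
    using assms sin_cos_squared_add[of "Re z"] by (auto simp: power2_eq_1_iff)
  then have "(exp (Im z) + exp (- Im z)) / 2 = \<bar>Re (sin z)\<bar>"
    by (simp add: Re_sin abs_mult)
  also have "\<dots> \<le> norm (sin z)" by (rule abs_Re_le_cmod)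
  finally have "(exp (Im z) + exp (- Im z)) / 2 \<le> norm (sin z)" .
  moreover have "exp \<bar>Im z\<bar> / 2 \<le> (exp (Im z) + exp (- Im z)) / 2" by (simp add: abs_if)
  ultimately show ?thesis by (rule order_trans[rotated])
qed

lemma norm_sin_ge_horizontal:
  assumes "\<bar>Im z\<bar> \<ge> 1"
  shows "norm (sin z) \<ge> exp \<bar>Im z\<bar> / 4"
proof -
  have "norm (sin z) = norm (exp (\<i> * z) - exp (- (\<i> * z))) / 2"
    by (simp add: sin_exp_eq norm_divide norm_mult)
  moreover have "norm (exp (\<i> * z) - exp (- (\<i> * z))) \<ge> \<bar>exp (- Im z) - exp (Im z)\<bar>"
    using norm_triangle_ineq3[of "exp (\<i> * z)" "exp (- (\<i> * z))"] by simp
  moreover have "\<bar>exp (- Im z) - exp (Im z)\<bar> \<ge> exp \<bar>Im z\<bar> - exp (- \<bar>Im z\<bar>)"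
    by (simp add: abs_if)
  moreover have "exp (- \<bar>Im z\<bar>) \<le> exp \<bar>Im z\<bar> / 2"
  proof -
    have "exp (- \<bar>Im z\<bar>) \<le> 1" using assms by simp
    moreover have "exp \<bar>Im z\<bar> \<ge> 2" using exp_ge_add_one_self[of "\<bar>Im z\<bar>"] assms by linarith
    ultimately show ?thesis by linarith
  qed
  ultimately show ?thesis by linarith
qed

lemma norm_contour_integral_vertical_le:
  assumes cont: "continuous_on (closed_segment (Complex x (-Y)) (Complex x Y)) h"
    and bd: "\<And>y. norm (h (Complex x y)) \<le> A * exp (- c * \<bar>y\<bar>)"
    and "c > 0" "Y > 0" "A \<ge> 0"
  shows "norm (contour_integral (linepath (Complex x (-Y)) (Complex x Y)) h) \<le> A * (2 / c)"
proof -
  have "contour_integral (linepath (Complex x (-Y)) (Complex x Y)) h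
      = \<i> * integral {-Y..Y} (\<lambda>y. h (Complex x y))"
    by (rule contour_integral_linepath_same_Re) (use assms in auto)
  moreover have "norm (integral {-Y..Y} (\<lambda>y. h (Complex x y))) \<le> integral {-Y..Y} (\<lambda>y. A * exp (- c * \<bar>y\<bar>))"
  proof (rule integral_norm_bound_integral)
    have "continuous_on {-Y..Y} (\<lambda>y. h (Complex x y))"
    proof (rule continuous_on_compose2[OF cont])
      show "continuous_on {-Y..Y} (\<lambda>y. Complex x y)" unfolding Complex_eq by (intro continuous_intros)
      show "Complex x ` {-Y..Y} \<subseteq> closed_segment (Complex x (-Y)) (Complex x Y)"
        using \<open>Y > 0\<close> by (auto simp: closed_segment_same_Re closed_segment_eq_real_ivl)
    qed
    then show "(\<lambda>y. h (Complex x y)) integrable_on {-Y..Y}" by (rule integrable_continuous_real)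
    show "(\<lambda>y. A * exp (- c * \<bar>y\<bar>)) integrable_on {-Y..Y}"
      using integral_exp_abs_le(1)[of c Y] assms by (intro integrable_on_mult_right) auto
  qed (use bd in auto)
  moreover have "integral {-Y..Y} (\<lambda>y. A * exp (- c * \<bar>y\<bar>)) \<le> A * (2 / c)"
    using mult_left_mono[OF integral_exp_abs_le(2)[of c Y] \<open>A \<ge> 0\<close>] assms by simp
  ultimately show ?thesis by (simp add: norm_mult)
qed

lemma contour_integral_rectpath:
  assumes "continuous_on (path_image (rectpath a b)) h"
  shows "contour_integral (rectpath a b) h =
           contour_integral (linepath a (Complex (Re b) (Im a))) h
         + contour_integral (linepath (Complex (Re b) (Im a)) b) h
         + contour_integral (linepath b (Complex (Re a) (Im b))) h
         + contour_integral (linepath (Complex (Re a) (Im b)) a) h"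
proof -
  define a2 a4 where "a2 = Complex (Re b) (Im a)" and "a4 = Complex (Re a) (Im b)"
  have "path_image (rectpath a b) = closed_segment a a2 \<union> (closed_segment a2 b \<union> (closed_segment b a4 \<union> closed_segment a4 a))"
    by (simp add: rectpath_def Let_def path_image_join a2_def a4_def)
  with assms have "h contour_integrable_on linepath a a2" "h contour_integrable_on linepath a2 b"
    "h contour_integrable_on linepath b a4" "h contour_integrable_on linepath a4 a"
    by (auto intro!: contour_integrable_continuous_linepath elim!: continuous_on_subset)
  then show ?thesis
    by (simp add: rectpath_def Let_def flip: a2_def a4_def)
qed

text \<open>
  The factor \<open>cos (n * pi) = \<plusminus>1\<close> arises as its own inverse, from the derivative of the sine. The
  function \<open>g\<close> may vanish at the node, in which case the singularity is removable; the limit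
  criterion for residues covers both cases.
\<close>

lemma residue_at_zero_of_sin:
  assumes "open S" and z: "of_real w * z = of_int n * of_real pi" "z \<in> S" and "w \<noteq> 0"
    and holg: "g holomorphic_on UNIV" and zt: "z \<noteq> t"
    and hol: "(\<lambda>x. g x / ((x - t) * sin (of_real w * x))) holomorphic_on S - {z}"
  shows "residue (\<lambda>x. g x / ((x - t) * sin (of_real w * x))) z
         = g z * of_real (cos (of_int n * pi)) / (of_real w * (z - t))"
proof (rule residue_simple'[OF \<open>open S\<close> z(2) hol])
  define k where "k = complex_of_real (cos (of_int n * pi))"
  have "(cos (of_int n * pi))\<^sup>2 = (1::real)"
    using cos_squared_eq[of "of_int n * pi"] sin_zero_iff_int2[of "of_int n * pi"] by auto
  then have kk: "k * k = 1" unfolding k_def of_real_mult[symmetric] by (simp add: power2_eq_square)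
  have wz: "of_real w * z = complex_of_real (of_int n * pi)" using z(1) by simp
  have "sin (of_int n * pi) = 0" using sin_zero_iff_int2[of "of_int n * pi"] by auto
  then have swz: "sin (of_real w * z) = 0" and cwz: "cos (of_real w * z) = k"
    unfolding wz k_def sin_of_real cos_of_real by simp_all
  have "((\<lambda>x. sin (of_real w * x)) has_field_derivative (k * of_real w)) (at z)"
    by (auto intro!: derivative_eq_intros simp: cwz)
  then have "((\<lambda>x. sin (of_real w * x) / (x - z)) \<longlongrightarrow> k * of_real w) (at z)"
    unfolding has_field_derivative_iff by (simp add: swz)
  moreover have kw: "k * of_real w \<noteq> 0" using kk \<open>w \<noteq> 0\<close> by auto
  ultimately have 1: "((\<lambda>x. inverse (sin (of_real w * x) / (x - z))) \<longlongrightarrow> inverse (k * of_real w)) (at z)"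
    by (rule tendsto_inverse)
  have "(g \<longlongrightarrow> g z) (at z)"
    using holg holomorphic_on_imp_continuous_on continuous_on_eq_continuous_at[of UNIV g] isCont_def by blast
  then have "((\<lambda>x. g x / (x - t) * inverse (sin (of_real w * x) / (x - z))) \<longlongrightarrow> g z / (z - t) * inverse (k * of_real w)) (at z)"
    by (intro tendsto_intros 1) (use zt in auto)
  moreover have "inverse k = k" using kk by (metis inverse_unique)
  ultimately show "((\<lambda>x. g x / ((x - t) * sin (of_real w * x)) * (x - z)) \<longlongrightarrow> g z * of_real (cos (of_int n * pi)) / (of_real w * (z - t))) (at z)"
    unfolding k_def[symmetric]
    by (simp add: inverse_mult_distrib) (simp add: field_simps)
qed

lemma sampling_indices_eq: "sampling_indices w N t = {\<lceil>t * w / pi - N\<rceil>..\<lfloor>t * w / pi + N\<rfloor>}"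
  by (rule set_eqI)
     (unfold sampling_indices_def mem_Collect_eq atLeastAtMost_iff ceiling_le_iff le_floor_iff abs_le_iff, linarith)

text \<open>
  If \<open>sin (w * t) = 0\<close>, then \<open>t\<close> is itself one of the nodes and the error is zero. Otherwise the
  residue theorem for \<open>g x / ((x - t) * sin (w * x))\<close> expresses the error as a contour integral, as
  described at the top. The constant comes from two vertical sides, each contributing
  \<open>2 * A / d * (2 / (w - a))\<close> with \<open>d = N * pi / (2 * w)\<close>.
\<close>

lemma sampling_truncation_error:
  fixes g :: "complex \<Rightarrow> complex"
  assumes hol: "g holomorphic_on UNIV" and "a < w" "0 < w" "N \<ge> 1"
    and bd: "\<And>z. norm (g z) \<le> A * exp (a * \<bar>Im z\<bar>)"
  shows "norm (g (of_real t) - (\<Sum>n\<in>sampling_indices w N t.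
            g (of_real (of_int n * pi / w)) * of_real (sinc (w * t - of_int n * pi))))
       \<le> 8 * A * w * \<bar>sin (w * t)\<bar> / (pi\<^sup>2 * real N * (w - a))" (is "norm ?E \<le> ?R")
proof (cases "sin (w * t) = 0")
  case True
  then obtain m :: int where m: "w * t = of_int m * pi" using sin_zero_iff_int2 by auto
  have mi: "m \<in> sampling_indices w N t"
    using m by (simp add: sampling_indices_def mult.commute)
  have tm: "of_int m * pi / w = t" using m \<open>0 < w\<close> by (simp add: field_simps)
  have "(\<Sum>n\<in>sampling_indices w N t. g (of_real (of_int n * pi / w)) * of_real (sinc (w * t - of_int n * pi)))
      = (\<Sum>n\<in>sampling_indices w N t. if n = m then g (of_real t) else 0)"
  proof (rule sum.cong[OF refl])
    fix n assume "n \<in> sampling_indices w N t"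
    show "g (of_real (of_int n * pi / w)) * of_real (sinc (w * t - of_int n * pi)) = (if n = m then g (of_real t) else 0)"
    proof (cases "n = m")
      case True then show ?thesis using m tm by simp
    next
      case False
      have "sin (w * t - of_int n * pi) = 0"
        using m sin_zero_iff_int2[of "w * t - of_int n * pi"] by (metis left_diff_distrib of_int_diff)
      then show ?thesis using False m by simp
    qed
  qed
  also have "\<dots> = g (of_real t)" using mi by (simp add: sampling_indices_eq)
  finally show ?thesis using True by simp
next
  case False
  have A0: "A \<ge> 0" using order_trans[OF norm_ge_zero bd[of 0]] by simp
  define l m where "l = \<lceil>t * w / pi - N\<rceil>" and "m = \<lfloor>t * w / pi + N\<rfloor>"
  \<comment> \<open>The vertical sides lie midway between the outermost node of the sum and its outer neighbour.\<close>
  define al be where "al = (of_int l - 1 / 2) * pi / w" and "be = (of_int m + 1 / 2) * pi / w"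
  define d where "d = real N * pi / (2 * w)"
  have d0: "d > 0" using \<open>0 < w\<close> \<open>N \<ge> 1\<close> by (simp add: d_def)
  have dist_al: "t - al \<ge> d"
  proof -
    have "of_int l < t * w / pi - N + 1" unfolding l_def by linarith
    then have "of_int l - 1/2 \<le> t * w / pi - N / 2" using \<open>N \<ge> 1\<close> by linarith
    then have "(of_int l - 1/2) * (pi / w) \<le> (t * w / pi - N / 2) * (pi / w)"
      using \<open>0 < w\<close> by (intro mult_right_mono) auto
    moreover have "(t * w / pi - N / 2) * (pi / w) = t - d"
      using \<open>0 < w\<close> by (simp add: d_def left_diff_distrib diff_divide_distrib)
    ultimately show ?thesis by (simp add: al_def)
  qed
  have dist_be: "be - t \<ge> d"
  proof -
    have "of_int m > t * w / pi + N - 1" unfolding m_def by linarith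
    then have "of_int m + 1/2 \<ge> t * w / pi + N / 2" using \<open>N \<ge> 1\<close> by linarith
    then have "(of_int m + 1/2) * (pi / w) \<ge> (t * w / pi + N / 2) * (pi / w)"
      using \<open>0 < w\<close> by (intro mult_right_mono) auto
    moreover have "(t * w / pi + N / 2) * (pi / w) = t + d"
      using \<open>0 < w\<close> by (simp add: d_def distrib_right add_divide_distrib)
    ultimately show ?thesis by (simp add: be_def)
  qed
  have al_t: "al < t" "t < be" using dist_al dist_be d0 by linarith+
  define h where "h = (\<lambda>x. g x / ((x - of_real t) * sin (of_real w * x)))"
  define node where "node = (\<lambda>n::int. complex_of_real (of_int n * pi / w))"
  \<comment> \<open>The open strip up to the two neighbouring nodes contains no further singularity.\<close>
  define S where "S = {z. (of_int l - 1) * pi / w < Re z \<and> Re z < (of_int m + 1) * pi / w}"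
  define pts where "pts = insert (of_real t) (node ` {l..m})"
  have wnode: "of_real w * node n = of_int n * of_real pi" for n
    using \<open>0 < w\<close> by (simp add: node_def)
  have injn: "inj_on node X" for X using \<open>0 < w\<close> by (auto simp: inj_on_def node_def)
  have node_t: "node n \<noteq> of_real t" for n
  proof
    assume "node n = of_real t"
    then have "of_int n * pi / w = t" unfolding node_def by (simp only: of_real_eq_iff)
    then have "w * t = of_int n * pi" using \<open>0 < w\<close> by (auto simp: field_simps)
    then show False using False sin_zero_iff_int2 by auto
  qed
  have oS: "open S" unfolding S_def
    by (intro open_Collect_conj open_Collect_less continuous_intros)
  have S_alt: "S = {z. (of_int l - 1) * pi / w < Re z} \<inter> {z. Re z < (of_int m + 1) * pi / w}"
    by (auto simp: S_def)
  have cS: "connected S" unfolding S_alt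
    by (intro convex_connected convex_Int convex_halfspace_Re_gt convex_halfspace_Re_lt)
  have sin0: "x \<in> node ` {l..m}" if "x \<in> S" "sin (of_real w * x) = 0" for x
  proof -
    obtain n :: int where n: "of_real w * x = of_real (of_int n * pi)"
      using \<open>sin (of_real w * x) = 0\<close> sin_eq_0 by auto
    then have xn: "x = node n" using \<open>0 < w\<close> by (simp add: node_def field_simps)
    have "(of_int l - 1) * (pi / w) < of_int n * (pi / w)" "of_int n * (pi / w) < (of_int m + 1) * (pi / w)"
      using \<open>x \<in> S\<close> by (simp_all add: xn node_def S_def)
    then have "(of_int l - 1 :: real) < of_int n" "of_int n < (of_int m + 1 :: real)"
      using \<open>0 < w\<close> by (auto simp: mult_less_cancel_right divide_less_cancel)
    then have "n \<in> {l..m}" by auto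
    then show ?thesis using xn by auto
  qed
  have hol_h: "h holomorphic_on S - pts" unfolding h_def
  proof (intro holomorphic_intros)
    show "g holomorphic_on S - pts" using hol holomorphic_on_subset by blast
    show "(x - of_real t) * sin (of_real w * x) \<noteq> 0" if "x \<in> S - pts" for x
      using that sin0 by (auto simp: pts_def)
  qed
  have fin: "finite pts" by (simp add: pts_def)
  have opts: "open (S - (pts - {z}))" for z
    using fin oS by (intro open_Diff finite_imp_closed) auto
  have pw: "pi / w > 0" using \<open>0 < w\<close> by simp
  have al_in: "(of_int l - 1) * pi / w < al" "be < (of_int m + 1) * pi / w"
    using \<open>0 < w\<close> by (auto simp: al_def be_def divide_strict_right_mono)
  have node_in: "al < Re (node n) \<and> Re (node n) < be" if "n \<in> {l..m}" for n
  proof -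
    have "(of_int l - 1/2) * (pi / w) < of_int n * (pi / w)" "of_int n * (pi / w) < (of_int m + 1/2) * (pi / w)"
      using that pw by (intro mult_strict_right_mono; simp; linarith)+
    then show ?thesis by (simp add: node_def al_def be_def)
  qed
  have res_t: "residue h (of_real t) = g (of_real t) / of_real (sin (w * t))"
  proof (rule residue_simple'[OF opts[of "of_real t"]])
    show "of_real t \<in> S - (pts - {of_real t})" using al_t al_in by (auto simp: S_def)
    show "h holomorphic_on S - (pts - {of_real t}) - {of_real t}"
      by (rule holomorphic_on_subset[OF hol_h]) auto
    have st: "sin (of_real w * of_real t :: complex) = of_real (sin (w * t))"
      by (metis of_real_mult sin_of_real)
    have "isCont (\<lambda>x. g x / sin (of_real w * x)) (of_real t)"
    proof (intro continuous_intros)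
      show "isCont g (of_real t)"
        using hol holomorphic_on_imp_continuous_on continuous_on_eq_continuous_at[of UNIV g] by blast
    qed (use False st in auto)
    then have "((\<lambda>x. g x / sin (of_real w * x)) \<longlongrightarrow> g (of_real t) / of_real (sin (w * t))) (at (of_real t))"
      unfolding isCont_def st .
    then show "((\<lambda>x. h x * (x - of_real t)) \<longlongrightarrow> g (of_real t) / of_real (sin (w * t))) (at (of_real t))"
      by (rule Lim_transform_eventually) (auto simp: h_def eventually_at_filter)
  qed
  have res_n: "residue h (node n) = g (node n) * of_real (cos (of_int n * pi)) / (of_real w * (node n - of_real t))"
    if "n \<in> {l..m}" for n
    unfolding h_def
  proof (rule residue_at_zero_of_sin[OF opts[of "node n"] wnode])
    show "node n \<in> S - (pts - {node n})" using node_in[OF that] al_in by (auto simp: S_def)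
    show "(\<lambda>x. g x / ((x - of_real t) * sin (of_real w * x))) holomorphic_on S - (pts - {node n}) - {node n}"
      using hol_h unfolding h_def by (rule holomorphic_on_subset) auto
  qed (use \<open>0 < w\<close> hol node_t in auto)
  have sum_res: "(\<Sum>p\<in>pts. residue h p) = ?E / of_real (sin (w * t))"
  proof -
    have "(\<Sum>p\<in>pts. residue h p) = residue h (of_real t) + (\<Sum>p\<in>node ` {l..m}. residue h p)"
      unfolding pts_def using node_t by (subst sum.insert) (auto dest: sym)
    also have "(\<Sum>p\<in>node ` {l..m}. residue h p) = (\<Sum>n\<in>{l..m}. residue h (node n))"
      by (simp add: sum.reindex injn)
    also have "\<dots> = (\<Sum>n\<in>{l..m}. - (g (node n) * of_real (sinc (w * t - of_int n * pi)) / of_real (sin (w * t))))"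
    proof (rule sum.cong[OF refl])
      fix n assume n: "n \<in> {l..m}"
      have ne: "w * t - of_int n * pi \<noteq> 0" using False sin_zero_iff_int2[of "w * t"] by auto
      have "sin (of_int n * pi) = 0" using sin_zero_iff_int2[of "of_int n * pi"] by auto
      then have "sin (w * t - of_int n * pi) = sin (w * t) * cos (of_int n * pi)"
        by (simp add: sin_diff)
      then have "sinc (w * t - of_int n * pi) / sin (w * t) = cos (of_int n * pi) / (w * t - of_int n * pi)"
        using ne False by simp
      then have "- (of_real (sinc (w * t - of_int n * pi)) / of_real (sin (w * t)) :: complex)
          = - of_real (cos (of_int n * pi) / (w * t - of_int n * pi))"
        by (metis of_real_divide)
      also have "\<dots> = of_real (cos (of_int n * pi)) / (of_int n * of_real pi - of_real w * of_real t)"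
        by (simp add: minus_divide_right)
      also have "\<dots> = of_real (cos (of_int n * pi)) / (of_real w * (node n - of_real t))"
        unfolding right_diff_distrib wnode ..
      finally show "residue h (node n) = - (g (node n) * of_real (sinc (w * t - of_int n * pi)) / of_real (sin (w * t)))"
        unfolding res_n[OF n] by (metis mult_minus_right times_divide_eq_right)
    qed
    finally show ?thesis
      unfolding res_t sampling_indices_eq l_def[symmetric] m_def[symmetric]
      by (simp add: node_def sum_negf diff_divide_distrib sum_divide_distrib)
  qed
  define Q where "Q = 2 * A / d * (2 / (w - a))"
  define \<delta> where "\<delta> = (\<lambda>Y. 2 * (4 * A * exp (a * Y - w * Y) / Y * (be - al)))"
  have contour: "2 * pi * (norm ?E / \<bar>sin (w * t)\<bar>) \<le> 2 * Q + \<delta> Y" if "Y \<ge> 1" "w * Y \<ge> 1" for Y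
  proof -
    define z1 z3 where "z1 = Complex al (-Y)" and "z3 = Complex be Y"
    have le: "Re z1 \<le> Re z3" "Im z1 \<le> Im z3" using al_t \<open>Y \<ge> 1\<close> by (auto simp: z1_def z3_def)
    have pts_box: "p \<in> box z1 z3" if "p \<in> pts" for p
      using that node_in al_t \<open>Y \<ge> 1\<close> by (auto simp: pts_def in_box_complex_iff z1_def z3_def node_def)
    have img: "path_image (rectpath z1 z3) \<subseteq> S - pts"
    proof
      fix x assume x: "x \<in> path_image (rectpath z1 z3)"
      then have "x \<in> cbox z1 z3" using path_image_rectpath_subset_cbox[OF le] by auto
      then have "x \<in> S" using al_in by (auto simp: S_def z1_def z3_def in_cbox_complex_iff)
      moreover have "x \<notin> pts" using x pts_box path_image_rectpath_inter_box[OF le] by auto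
      ultimately show "x \<in> S - pts" by auto
    qed
    have "contour_integral (rectpath z1 z3) h
        = 2 * pi * \<i> * (\<Sum>p\<in>pts. winding_number (rectpath z1 z3) p * residue h p)"
    proof (rule Residue_theorem[OF oS cS fin hol_h _ _ img])
      show "\<forall>z. z \<notin> S \<longrightarrow> winding_number (rectpath z1 z3) z = 0"
      proof (intro allI impI)
        fix z assume "z \<notin> S"
        then have "z \<notin> cbox z1 z3" using al_in by (auto simp: S_def z1_def z3_def in_cbox_complex_iff)
        then show "winding_number (rectpath z1 z3) z = 0" by (rule winding_number_rectpath_outside[OF le])
      qed
    qed auto
    also have "(\<Sum>p\<in>pts. winding_number (rectpath z1 z3) p * residue h p) = (\<Sum>p\<in>pts. residue h p)"
      by (rule sum.cong) (auto simp: winding_number_rectpath pts_box)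
    finally have CI: "contour_integral (rectpath z1 z3) h = 2 * pi * \<i> * (?E / of_real (sin (w * t)))"
      unfolding sum_res .
    have conth: "continuous_on (path_image (rectpath z1 z3)) h"
      by (meson hol_h holomorphic_on_imp_continuous_on continuous_on_subset img)
    have vert: "norm (h (Complex x y)) \<le> 2 * A / d * exp (- (w - a) * \<bar>y\<bar>)"
      if x: "cos (w * x) = 0" "\<bar>x - t\<bar> \<ge> d" for x y
    proof -
      have "exp (w * \<bar>y\<bar>) / 2 \<le> norm (sin (of_real w * Complex x y))"
        using norm_sin_ge_vertical[of "of_real w * Complex x y"] x(1) \<open>0 < w\<close> by (simp add: abs_mult)
      moreover have "d \<le> norm (Complex x y - of_real t)"
        using x(2) abs_Re_le_cmod[of "Complex x y - of_real t"] by simp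
      ultimately have "d * (exp (w * \<bar>y\<bar>) / 2) \<le> norm ((Complex x y - of_real t) * sin (of_real w * Complex x y))"
        unfolding norm_mult using d0 by (intro mult_mono) auto
      moreover have "norm (g (Complex x y)) \<le> A * exp (a * \<bar>y\<bar>)" using bd[of "Complex x y"] by simp
      ultimately have "norm (h (Complex x y)) \<le> A * exp (a * \<bar>y\<bar>) / (d * (exp (w * \<bar>y\<bar>) / 2))"
        unfolding h_def norm_divide using d0 A0 by (intro frac_le) auto
      also have "\<dots> = 2 * A / d * (exp (a * \<bar>y\<bar>) / exp (w * \<bar>y\<bar>))" by simp
      also have "exp (a * \<bar>y\<bar>) / exp (w * \<bar>y\<bar>) = exp (- (w - a) * \<bar>y\<bar>)"
        by (simp add: exp_diff[symmetric] algebra_simps)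
      finally show ?thesis .
    qed
    have seg_h: "norm (h z) \<le> 4 * A * exp (a * Y - w * Y) / Y" if "\<bar>Im z\<bar> = Y" for z
    proof -
      have "exp (w * Y) / 4 \<le> norm (sin (of_real w * z))"
        using norm_sin_ge_horizontal[of "of_real w * z"] that \<open>0 < w\<close> \<open>w * Y \<ge> 1\<close> by (simp add: abs_mult)
      moreover have "Y \<le> norm (z - of_real t)"
        using that abs_Im_le_cmod[of "z - of_real t"] by simp
      ultimately have "Y * (exp (w * Y) / 4) \<le> norm ((z - of_real t) * sin (of_real w * z))"
        unfolding norm_mult using \<open>Y \<ge> 1\<close> by (intro mult_mono) auto
      moreover have "norm (g z) \<le> A * exp (a * Y)" using bd[of z] that by simp
      ultimately have "norm (h z) \<le> A * exp (a * Y) / (Y * (exp (w * Y) / 4))"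
        unfolding h_def norm_divide using \<open>Y \<ge> 1\<close> A0 by (intro frac_le) auto
      also have "\<dots> = 4 * A * exp (a * Y - w * Y) / Y" by (simp add: exp_diff mult.commute)
      finally show ?thesis .
    qed
    have hor: "norm (contour_integral (linepath z z') h) \<le> 4 * A * exp (a * Y - w * Y) / Y * (be - al)"
      if "closed_segment z z' \<subseteq> path_image (rectpath z1 z3)" "\<bar>Im z\<bar> = Y" "Im z' = Im z" "\<bar>Re z' - Re z\<bar> = be - al" for z z'
    proof -
      have "norm (contour_integral (linepath z z') h) \<le> 4 * A * exp (a * Y - w * Y) / Y * norm (z' - z)"
      proof (rule contour_integral_bound_linepath)
        show "h contour_integrable_on linepath z z'"
          using conth that(1) by (intro contour_integrable_continuous_linepath) (rule continuous_on_subset)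
        show "0 \<le> 4 * A * exp (a * Y - w * Y) / Y" using A0 \<open>Y \<ge> 1\<close> by simp
        show "norm (h x) \<le> 4 * A * exp (a * Y - w * Y) / Y" if "x \<in> closed_segment z z'" for x
          using that \<open>Im z' = Im z\<close> \<open>\<bar>Im z\<bar> = Y\<close> by (intro seg_h) (auto simp: closed_segment_same_Im)
      qed
      also have "norm (z' - z) = be - al" using that by (simp add: cmod_def)
      finally show ?thesis .
    qed
    define z2 z4 where "z2 = Complex be (-Y)" and "z4 = Complex al Y"
    have img4: "path_image (rectpath z1 z3) = closed_segment z1 z2 \<union> (closed_segment z2 z3 \<union> (closed_segment z3 z4 \<union> closed_segment z4 z1))"
      by (simp add: rectpath_def Let_def path_image_join z1_def z2_def z3_def z4_def)
    have cos_be: "cos (w * be) = 0" and cos_al: "cos (w * al) = 0"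
    proof -
      have "w * be = of_int (2 * m + 1) * (pi / 2)" "w * al = of_int (2 * (l - 1) + 1) * (pi / 2)"
        using \<open>0 < w\<close> by (simp_all add: be_def al_def field_simps)
      then show "cos (w * be) = 0" "cos (w * al) = 0"
        unfolding cos_zero_iff_int by (metis odd_two_times_div_two_succ even_add even_mult_iff even_numeral odd_one)+
    qed
    have 1: "norm (contour_integral (linepath z1 z2) h) \<le> 4 * A * exp (a * Y - w * Y) / Y * (be - al)"
      by (rule hor) (use al_t \<open>Y \<ge> 1\<close> in \<open>auto simp: img4\<close>, auto simp: z1_def z2_def)
    have 3: "norm (contour_integral (linepath z3 z4) h) \<le> 4 * A * exp (a * Y - w * Y) / Y * (be - al)"
      by (rule hor) (use al_t \<open>Y \<ge> 1\<close> in \<open>auto simp: img4\<close>, auto simp: z3_def z4_def)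
    have contseg: "continuous_on (closed_segment z2 z3) h" "continuous_on (closed_segment z4 z1) h"
      by (rule continuous_on_subset[OF conth], force simp: img4)+
    have 2: "norm (contour_integral (linepath z2 z3) h) \<le> Q"
      unfolding Q_def z2_def z3_def
      by (rule norm_contour_integral_vertical_le[OF contseg(1)[unfolded z2_def z3_def] vert[OF cos_be]])
         (use dist_be d0 \<open>a < w\<close> \<open>Y \<ge> 1\<close> A0 in auto)
    have "norm (contour_integral (linepath z1 z4) h) \<le> Q"
      unfolding Q_def z1_def z4_def
      by (rule norm_contour_integral_vertical_le[OF contseg(2)[unfolded z1_def z4_def, unfolded closed_segment_commute[of "Complex al Y"]] vert[OF cos_al]])
         (use dist_al d0 \<open>a < w\<close> \<open>Y \<ge> 1\<close> A0 in auto)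
    then have 4: "norm (contour_integral (linepath z4 z1) h) \<le> Q"
      using contour_integral_reverse_linepath[OF contseg(2)] by simp
    have "norm (contour_integral (rectpath z1 z3) h) \<le> 2 * Q + \<delta> Y"
      using contour_integral_rectpath[OF conth] norm_triangle_mono[OF norm_triangle_mono[OF norm_triangle_mono[OF 1 2] 3] 4]
      by (simp add: z1_def z2_def z3_def z4_def \<delta>_def mult_ac)
    moreover have "norm (contour_integral (rectpath z1 z3) h) = 2 * pi * (norm ?E / \<bar>sin (w * t)\<bar>)"
      unfolding CI norm_mult norm_divide by simp
    ultimately show ?thesis by simp
  qed
  have "(\<delta> \<longlongrightarrow> 0) at_top"
    using \<open>a < w\<close> unfolding \<delta>_def by real_asymp
  then have "((\<lambda>Y. 2 * Q + \<delta> Y) \<longlongrightarrow> 2 * Q + 0) at_top" by (intro tendsto_intros)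
  then have "2 * pi * (norm ?E / \<bar>sin (w * t)\<bar>) \<le> 2 * Q + 0"
  proof (rule tendsto_lowerbound)
    show "\<forall>\<^sub>F Y in at_top. 2 * pi * (norm ?E / \<bar>sin (w * t)\<bar>) \<le> 2 * Q + \<delta> Y"
      using eventually_ge_at_top[of 1] eventually_ge_at_top[of "1 / w"]
    proof eventually_elim
      case (elim Y)
      then show ?case using \<open>0 < w\<close> by (intro contour) (auto simp: field_simps)
    qed
  qed simp
  then have "norm ?E \<le> Q * \<bar>sin (w * t)\<bar> / pi" using False by (simp add: field_simps)
  also have "\<dots> = ?R" using \<open>0 < w\<close> \<open>N \<ge> 1\<close> by (simp add: Q_def d_def field_simps power2_eq_square)
  finally show ?thesis .
qed

text \<open>
  The constant in \<open>truncation_const\<close> is larger than needed by a factor of about \<open>pi / 2\<close>, so that the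
  exponent \<open>a\<close> may be a fixed number above \<open>\<gamma>\<close>.
\<close>

lemma kernel_truncation_error:
  fixes g :: "complex \<Rightarrow> complex"
  assumes hol: "g holomorphic_on UNIV"
    and ls: "limsup (\<lambda>n. ereal (root n (cmod ((deriv ^^ n) g 0)))) \<le> ereal \<gamma>"
    and "0 \<le> \<gamma>" "\<gamma> < w" "N \<ge> 1"
    and bd: "\<And>x. cmod (g (of_real x)) \<le> K"
  shows "norm (g (of_real t) - (\<Sum>n\<in>sampling_indices w N t.
            g (of_real (of_int n * pi / w)) * of_real (sinc (w * t - of_int n * pi))))
       \<le> truncation_const K w \<gamma> t / real N" (is "norm ?E \<le> _")
proof -
  \<comment> \<open>This choice replaces \<open>w - \<gamma>\<close> by two thirds of it, which costs the factor \<open>3 / 2\<close>; the final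
     comparison needs \<open>3 / pi \<le> 1\<close>.\<close>
  define a where "a = \<gamma> + (w - \<gamma>) / 3"
  have a: "\<gamma> < a" "a < w" "0 \<le> a" and wa: "w - a = 2 / 3 * (w - \<gamma>)"
    using assms by (simp_all add: a_def field_simps)
  have K0: "K \<ge> 0" using order_trans[OF norm_ge_zero bd[of 0]] by simp
  have "limsup (\<lambda>n. ereal (root n (cmod ((deriv ^^ n) g 0)))) < ereal a"
    using ls a(1) by (meson ereal_less_ereal_Ex le_less_trans less_ereal.simps(1))
  then obtain C where C: "\<And>z. norm (g z) \<le> C * exp (a * norm z)"
    using exponential_growth_of_derivatives_at_0[OF hol \<open>0 \<le> a\<close>] by blast
  define c where "c = 4 * w * \<bar>sin (w * t)\<bar> / (pi * (w - \<gamma>) * (1 - exp (- pi))) / N"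
  have e1: "0 < 1 - exp (- pi)" "1 - exp (- pi) \<le> 1" using pi_gt_zero by simp_all
  have main: "norm ?E \<le> c * (K + e)" if "e > 0" for e
  proof -
    have Ke: "K + e > 0" using K0 that by simp
    have bde: "cmod (g (of_real x)) \<le> K + e" for x using bd[of x] that by linarith
    have "norm (g z) \<le> (K + e) * exp (a * \<bar>Im z\<bar>)" for z
      by (rule exponential_type_bounded_on_real_line[OF hol Ke \<open>0 \<le> a\<close> C bde])
    then have "norm ?E \<le> 8 * (K + e) * w * \<bar>sin (w * t)\<bar> / (pi\<^sup>2 * real N * (w - a))"
      using assms a by (intro sampling_truncation_error[OF hol]) auto
    also have "\<dots> = 3 / pi * (4 * (K + e) * w * \<bar>sin (w * t)\<bar> / (pi * (w - \<gamma>)) / N)"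
    proof -
      define v where "v = w - \<gamma>"
      have "v > 0" using assms by (simp add: v_def)
      then show ?thesis using \<open>N \<ge> 1\<close> unfolding wa v_def[symmetric] by (simp add: field_simps power2_eq_square)
    qed
    also have "\<dots> \<le> 1 * (4 * (K + e) * w * \<bar>sin (w * t)\<bar> / (pi * (w - \<gamma>)) / N)"
      using assms Ke pi_gt3 by (intro mult_right_mono divide_nonneg_nonneg mult_nonneg_nonneg) auto
    also have "\<dots> \<le> 4 * (K + e) * w * \<bar>sin (w * t)\<bar> / (pi * (w - \<gamma>) * (1 - exp (- pi))) / N"
    proof -
      have "pi * (w - \<gamma>) * (1 - exp (- pi)) \<le> pi * (w - \<gamma>)"
        using e1 assms by (intro mult_left_le) auto
      moreover have "0 < pi * (w - \<gamma>) * (1 - exp (- pi))" using e1 assms by simp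
      ultimately show ?thesis
        using assms Ke by (simp add: divide_right_mono frac_le)
    qed
    also have "\<dots> = c * (K + e)" by (simp add: c_def mult_ac)
    finally show ?thesis .
  qed
  have "((\<lambda>e. c * (K + e)) \<longlongrightarrow> c * (K + 0)) (at_right 0)" by (intro tendsto_intros)
  then have "norm ?E \<le> c * (K + 0)"
    by (rule le_limit_at_right_0) (rule main)
  then show ?thesis by (simp add: c_def truncation_const_def mult_ac)
qed

section \<open>Integrals with respect to a complex measure\<close>

definition signed_measure :: "'a measure \<Rightarrow> ('a set \<Rightarrow> real) \<Rightarrow> bool" where
  "signed_measure N G \<longleftrightarrow> G {} = 0 \<and>
     (\<forall>A :: nat \<Rightarrow> 'a set. range A \<subseteq> sets N \<longrightarrow> disjoint_family A \<longrightarrow>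
        (\<lambda>i. G (A i)) sums G (\<Union>i. A i))"

text \<open>
  The real-valued counterpart of \<open>upper_variation_measure\<close>. Arguing with real suprema keeps
  subtraction available, which the proofs of additivity use.
\<close>

definition upper_variation :: "'a measure \<Rightarrow> ('a set \<Rightarrow> real) \<Rightarrow> 'a set \<Rightarrow> real" where
  "upper_variation N G A = (SUP S\<in>{S \<in> sets N. S \<subseteq> A}. G S)"

lemma signed_measure_Un:
  assumes "signed_measure N G" "A \<in> sets N" "B \<in> sets N" "A \<inter> B = {}"
  shows "G (A \<union> B) = G A + G B"
proof -
  have G0: "G {} = 0" and sums: "\<And>A :: nat \<Rightarrow> _. range A \<subseteq> sets N \<Longrightarrow> disjoint_family A \<Longrightarrow> (\<lambda>i. G (A i)) sums G (\<Union>i. A i)"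
    using assms(1) by (auto simp: signed_measure_def)
  have "(\<lambda>i. G (binaryset A B i)) sums G (\<Union>i. binaryset A B i)"
    using assms by (intro sums) (auto simp: disjoint_family_on_def binaryset_def)
  moreover have "(\<lambda>i. G (binaryset A B i)) sums (G A + G B)"
    by (rule binaryset_sums) (rule G0)
  ultimately show ?thesis by (metis UN_binaryset_eq sums_unique2)
qed

lemma signed_measure_Diff:
  assumes "signed_measure N G" "A \<in> sets N" "S \<in> sets N" "S \<subseteq> A"
  shows "G (A - S) = G A - G S"
  using signed_measure_Un[OF assms(1,3), of "A - S"] assms by (simp add: Un_absorb1)

lemma signed_measure_uminus: "signed_measure N G \<Longrightarrow> signed_measure N (\<lambda>A. - G A)"
  by (auto simp: signed_measure_def intro!: sums_minus)

context
  fixes N :: "'a measure" and G :: "'a set \<Rightarrow> real" and C :: real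
  assumes G: "signed_measure N G" and C: "\<And>S. S \<in> sets N \<Longrightarrow> G S \<le> C"
begin

lemma upper_variation_upper: "S \<in> sets N \<Longrightarrow> S \<subseteq> A \<Longrightarrow> G S \<le> upper_variation N G A"
  unfolding upper_variation_def by (rule cSUP_upper) (auto intro!: bdd_aboveI2[where M = C] C)

lemma upper_variation_least: "(\<And>S. S \<in> sets N \<Longrightarrow> S \<subseteq> A \<Longrightarrow> G S \<le> x) \<Longrightarrow> upper_variation N G A \<le> x"
  unfolding upper_variation_def by (rule cSUP_least) auto

lemma upper_variation_nonneg: "0 \<le> upper_variation N G A"
  using upper_variation_upper[of "{}" A] G by (simp add: signed_measure_def)

lemma upper_variation_empty: "upper_variation N G {} = 0"
  using upper_variation_least[of "{}" 0] upper_variation_nonneg[of "{}"] G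
  by (simp add: signed_measure_def order_antisym)

lemma upper_variation_mono: "A \<subseteq> B \<Longrightarrow> upper_variation N G A \<le> upper_variation N G B"
  by (rule upper_variation_least) (auto intro: upper_variation_upper)

lemma upper_variation_superadditive:
  assumes "A \<inter> B = {}"
  shows "upper_variation N G A + upper_variation N G B \<le> upper_variation N G (A \<union> B)"
proof -
  have "upper_variation N G A \<le> upper_variation N G (A \<union> B) - upper_variation N G B"
  proof (rule upper_variation_least)
    fix S assume S: "S \<in> sets N" "S \<subseteq> A"
    have "upper_variation N G B \<le> upper_variation N G (A \<union> B) - G S"
    proof (rule upper_variation_least)
      fix T assume T: "T \<in> sets N" "T \<subseteq> B"
      have "G (S \<union> T) = G S + G T" using S T assms by (intro signed_measure_Un[OF G]) auto
      moreover have "G (S \<union> T) \<le> upper_variation N G (A \<union> B)"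
        using S T by (intro upper_variation_upper) auto
      ultimately show "G T \<le> upper_variation N G (A \<union> B) - G S" by linarith
    qed
    then show "G S \<le> upper_variation N G (A \<union> B) - upper_variation N G B" by linarith
  qed
  then show ?thesis by linarith
qed

text \<open>
  Partial sums are at most the value on the union by superadditivity; conversely a
  measurable subset of the union is cut by the \<open>A i\<close> into pieces whose values add up.
\<close>

lemma upper_variation_sums:
  assumes A: "range A \<subseteq> sets N" "disjoint_family A"
  shows "(\<lambda>i. upper_variation N G (A i)) sums upper_variation N G (\<Union>i. A i)"
proof -
  let ?p = "upper_variation N G"
  have part: "(\<Sum>i<n. ?p (A i)) \<le> ?p (\<Union>i<n. A i)" for n
  proof (induction n)
    case 0 then show ?case by (simp add: upper_variation_empty)
  next
    case (Suc n)
    have "A i \<inter> A n = {}" if "i < n" for i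
      using A(2) that by (simp add: disjoint_family_on_def)
    then have disj: "(\<Union>i<n. A i) \<inter> A n = {}" by blast
    have "(\<Sum>i<Suc n. ?p (A i)) \<le> ?p (\<Union>i<n. A i) + ?p (A n)" using Suc by simp
    also have "\<dots> \<le> ?p ((\<Union>i<n. A i) \<union> A n)" by (rule upper_variation_superadditive[OF disj])
    also have "(\<Union>i<n. A i) \<union> A n = (\<Union>i<Suc n. A i)" by (simp add: lessThan_Suc Un_commute)
    finally show ?case .
  qed
  have le: "(\<Sum>i<n. ?p (A i)) \<le> ?p (\<Union>i. A i)" for n
    by (rule order_trans[OF part upper_variation_mono]) auto
  have summ: "summable (\<lambda>i. ?p (A i))"
    by (rule summableI_nonneg_bounded[OF upper_variation_nonneg le])
  moreover have "(\<Sum>i. ?p (A i)) \<le> ?p (\<Union>i. A i)" by (rule suminf_le_const[OF summ le])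
  moreover have "?p (\<Union>i. A i) \<le> (\<Sum>i. ?p (A i))"
  proof (rule upper_variation_least)
    fix S assume S: "S \<in> sets N" "S \<subseteq> (\<Union>i. A i)"
    have "(\<lambda>i. G (S \<inter> A i)) sums G (\<Union>i. S \<inter> A i)"
    proof -
      have "range (\<lambda>i. S \<inter> A i) \<subseteq> sets N" "disjoint_family (\<lambda>i. S \<inter> A i)"
        using S A by (auto simp: disjoint_family_on_def) blast
      then show ?thesis using G unfolding signed_measure_def by blast
    qed
    moreover have "(\<Union>i. S \<inter> A i) = S" using S by auto
    ultimately have "(\<lambda>i. G (S \<inter> A i)) sums G S" by simp
    moreover have "G (S \<inter> A i) \<le> ?p (A i)" for i
      using S A by (intro upper_variation_upper) auto
    ultimately show "G S \<le> (\<Sum>i. ?p (A i))"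
      by (intro sums_le[OF _ _ summable_sums[OF summ]])
  qed
  ultimately show ?thesis by (simp add: sums_iff)
qed

lemma sets_upper_variation_measure: "sets (upper_variation_measure N G) = sets N"
  and space_upper_variation_measure: "space (upper_variation_measure N G) = space N"
  unfolding upper_variation_measure_def by (simp_all add: sets.sigma_sets_eq sets.space_closed)

lemma emeasure_upper_variation_measure:
  assumes "A \<in> sets N"
  shows "emeasure (upper_variation_measure N G) A = ennreal (upper_variation N G A)"
proof -
  let ?P = "\<lambda>A. SUP S \<in> {S \<in> sets N. S \<subseteq> A}. ennreal (G S)"
  have P: "?P A = ennreal (upper_variation N G A)" for A
  proof (rule antisym)
    show "?P A \<le> ennreal (upper_variation N G A)"
      by (rule SUP_least) (auto intro!: ennreal_leI upper_variation_upper)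
    then obtain r where r: "?P A = ennreal r" "0 \<le> r"
      by (cases "?P A" rule: ennreal_cases) (auto simp: top_unique)
    have "upper_variation N G A \<le> r"
    proof (rule upper_variation_least)
      fix S assume "S \<in> sets N" "S \<subseteq> A"
      then have "ennreal (G S) \<le> ?P A" by (intro SUP_upper) auto
      then show "G S \<le> r" unfolding r(1) using r(2) by (simp add: ennreal_le_iff)
    qed
    then show "ennreal (upper_variation N G A) \<le> ?P A" unfolding r(1) by (rule ennreal_leI)
  qed
  have "emeasure (upper_variation_measure N G) A = ?P A"
    unfolding upper_variation_measure_def
  proof (rule emeasure_measure_of_sigma[OF sets.sigma_algebra_axioms _ _ assms])
    show "positive (sets N) ?P" unfolding P by (simp add: positive_def upper_variation_empty)
    show "countably_additive (sets N) ?P" unfolding P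
    proof (rule countably_additiveI)
      fix A :: "nat \<Rightarrow> 'a set" assume A: "range A \<subseteq> sets N" "disjoint_family A"
      show "(\<Sum>i. ennreal (upper_variation N G (A i))) = ennreal (upper_variation N G (\<Union>i. A i))"
        using upper_variation_sums[OF A] upper_variation_nonneg by (simp add: suminf_ennreal2 sums_iff)
    qed
  qed
  then show ?thesis unfolding P .
qed

lemma finite_upper_variation_measure: "finite_measure (upper_variation_measure N G)"
  by (rule finite_measureI)
     (simp add: space_upper_variation_measure emeasure_upper_variation_measure)

lemma measure_upper_variation_measure:
  "A \<in> sets N \<Longrightarrow> measure (upper_variation_measure N G) A = upper_variation N G A"
  by (simp add: measure_def emeasure_upper_variation_measure upper_variation_nonneg)

end

text \<open>
  Since \<open>G S = G A + (- G (A - S))\<close>, maximising \<open>G\<close> over subsets of \<open>A\<close> is the same as maximising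
  \<open>- G\<close> over the complements in \<open>A\<close>, up to the constant \<open>G A\<close>.
\<close>

lemma Jordan_decomposition:
  assumes G: "signed_measure N G" and C: "\<And>S. S \<in> sets N \<Longrightarrow> \<bar>G S\<bar> \<le> C" and A: "A \<in> sets N"
  shows "upper_variation N G A - upper_variation N (\<lambda>A. - G A) A = G A"
proof -
  have C1: "\<And>S. S \<in> sets N \<Longrightarrow> G S \<le> C" and C2: "\<And>S. S \<in> sets N \<Longrightarrow> - G S \<le> C"
    using C by (auto simp: abs_le_iff)
  note G2 = signed_measure_uminus[OF G]
  have "upper_variation N G A \<le> G A + upper_variation N (\<lambda>A. - G A) A"
  proof (rule upper_variation_least[OF G C1])
    fix S assume S: "S \<in> sets N" "S \<subseteq> A"
    have "- G (A - S) \<le> upper_variation N (\<lambda>A. - G A) A"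
      using S A by (intro upper_variation_upper[OF G2 C2]) auto
    then show "G S \<le> G A + upper_variation N (\<lambda>A. - G A) A"
      using signed_measure_Diff[OF G A S] by linarith
  qed
  moreover have "upper_variation N (\<lambda>A. - G A) A \<le> upper_variation N G A - G A"
  proof (rule upper_variation_least[OF G2 C2])
    fix S assume S: "S \<in> sets N" "S \<subseteq> A"
    have "G (A - S) \<le> upper_variation N G A"
      using S A by (intro upper_variation_upper[OF G C1]) auto
    then show "- G S \<le> upper_variation N G A - G A"
      using signed_measure_Diff[OF G A S] by linarith
  qed
  ultimately show ?thesis by linarith
qed

lemma signed_measure_Re: "complex_measure N F \<Longrightarrow> signed_measure N (\<lambda>A. Re (F A))"
  and signed_measure_Im: "complex_measure N F \<Longrightarrow> signed_measure N (\<lambda>A. Im (F A))"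
  by (auto simp: complex_measure_def signed_measure_def sums_complex_iff)

context
  fixes N :: "'a measure" and F :: "'a set \<Rightarrow> complex"
  assumes F: "complex_measure N F" and var_finite: "variation N F (space N) < \<infinity>"
begin

lemma sum_norm_le_total_variation:
  assumes "finite P" "disjoint P" "P \<subseteq> sets N" "\<Union>P = space N"
  shows "(\<Sum>S\<in>P. cmod (F S)) \<le> total_variation N F"
proof -
  have "ennreal (\<Sum>S\<in>P. cmod (F S)) = (\<Sum>S\<in>P. ennreal (cmod (F S)))" by (rule sum_ennreal[symmetric]) simp
  also have "\<dots> \<le> variation N F (space N)"
    unfolding variation_def by (rule SUP_upper) (use assms in auto)
  also have "\<dots> = ennreal (total_variation N F)"
    using var_finite by (simp add: total_variation_def)
  finally show ?thesis by (simp add: total_variation_def ennreal_le_iff)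
qed

lemma norm_le_total_variation:
  assumes "S \<in> sets N"
  shows "cmod (F S) \<le> total_variation N F"
proof -
  have "cmod (F S) \<le> (\<Sum>S\<in>{S, space N - S}. cmod (F S))"
    by (rule member_le_sum) auto
  also have "\<dots> \<le> total_variation N F"
    using assms sets.sets_into_space[OF assms]
    by (intro sum_norm_le_total_variation) (auto simp: disjoint_def)
  finally show ?thesis .
qed

lemma abs_Re_Im_bounds:
  assumes "S \<in> sets N"
  shows "\<bar>Re (F S)\<bar> \<le> total_variation N F" "\<bar>Im (F S)\<bar> \<le> total_variation N F"
  using norm_le_total_variation[OF assms] abs_Re_le_cmod[of "F S"] abs_Im_le_cmod[of "F S"] by linarith+

text \<open>
  The four real set functions that enter \<open>complex_measure_integral\<close>, named so that each fact about
  them is proved once.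
\<close>

definition jordan_part :: "('a set \<Rightarrow> real) \<Rightarrow> bool" where
  "jordan_part G \<longleftrightarrow> G \<in> {\<lambda>A. Re (F A), \<lambda>A. - Re (F A), \<lambda>A. Im (F A), \<lambda>A. - Im (F A)}"

lemma jordan_part_signed: "jordan_part G \<Longrightarrow> signed_measure N G"
  using signed_measure_Re[OF F] signed_measure_Im[OF F]
  by (auto simp: jordan_part_def intro: signed_measure_uminus)

lemma jordan_part_bound: "jordan_part G \<Longrightarrow> S \<in> sets N \<Longrightarrow> G S \<le> total_variation N F"
  using abs_Re_Im_bounds[of S] by (auto simp: jordan_part_def abs_le_iff)

lemma integrable_jordan_part:
  fixes g :: "'a \<Rightarrow> complex"
  assumes "jordan_part G" "g \<in> borel_measurable N" "\<And>x. x \<in> space N \<Longrightarrow> cmod (g x) \<le> K"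
  shows "integrable (upper_variation_measure N G) g"
proof -
  interpret finite_measure "upper_variation_measure N G"
    by (rule finite_upper_variation_measure[OF jordan_part_signed[OF assms(1)] jordan_part_bound[OF assms(1)]])
  have sets_eq: "sets (upper_variation_measure N G) = sets N"
    by (rule sets_upper_variation_measure[OF jordan_part_signed[OF assms(1)] jordan_part_bound[OF assms(1)]])
  have "AE x in upper_variation_measure N G. norm (g x) \<le> K"
    using assms(3) sets_eq_imp_space_eq[OF sets_eq] by (intro AE_I2) auto
  then show ?thesis
    by (rule integrable_const_bound) (use assms(2) measurable_cong_sets[OF sets_eq refl] in auto)
qed

lemma jordan_parts: 
  "jordan_part (\<lambda>A. Re (F A))" "jordan_part (\<lambda>A. - Re (F A))" "jordan_part (\<lambda>A. Im (F A))" "jordan_part (\<lambda>A. - Im (F A))"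
  by (auto simp: jordan_part_def)

lemma complex_measure_integral_sum:
  fixes g :: "'i \<Rightarrow> 'a \<Rightarrow> complex"
  assumes "\<And>i. i \<in> I \<Longrightarrow> g i \<in> borel_measurable N" "\<And>i x. i \<in> I \<Longrightarrow> x \<in> space N \<Longrightarrow> cmod (g i x) \<le> K i"
  shows "complex_measure_integral N F (\<lambda>x. \<Sum>i\<in>I. c i * g i x) = (\<Sum>i\<in>I. c i * complex_measure_integral N F (g i))"
proof -
  have "(LINT x|upper_variation_measure N G. (\<Sum>i\<in>I. c i * g i x)) = (\<Sum>i\<in>I. c i * (LINT x|upper_variation_measure N G. g i x))"
    if "jordan_part G" for G
    using integrable_jordan_part[OF that assms] by (simp add: Bochner_Integration.integral_sum)
  note * = this[OF jordan_parts(1)] this[OF jordan_parts(2)] this[OF jordan_parts(3)] this[OF jordan_parts(4)]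
  show ?thesis unfolding complex_measure_integral_def *
    by (simp add: sum_distrib_left sum_subtractf[symmetric] sum.distrib[symmetric] algebra_simps)
qed

lemma complex_measure_integral_indicator:
  assumes "S \<in> sets N"
  shows "complex_measure_integral N F (indicator S) = F S"
proof -
  have "(LINT x|upper_variation_measure N G. indicator S x :: complex) = of_real (upper_variation N G S)"
    if "jordan_part G" for G
  proof -
    note J = jordan_part_signed[OF that] jordan_part_bound[OF that]
    have "S \<inter> space (upper_variation_measure N G) = S"
      using assms sets.sets_into_space[OF assms] by (simp add: space_upper_variation_measure[OF J] Int_absorb2)
    moreover have "indicator S x = complex_of_real (indicator S x)" for x by (simp add: indicator_def)
    ultimately show ?thesis
      using measure_upper_variation_measure[OF J assms] by simp
  qed
  note * = this[OF jordan_parts(1)] this[OF jordan_parts(2)] this[OF jordan_parts(3)] this[OF jordan_parts(4)]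
  have "upper_variation N (\<lambda>A. Re (F A)) S - upper_variation N (\<lambda>A. - Re (F A)) S = Re (F S)"
    by (rule Jordan_decomposition[OF signed_measure_Re[OF F] abs_Re_Im_bounds(1) assms])
  moreover have "upper_variation N (\<lambda>A. Im (F A)) S - upper_variation N (\<lambda>A. - Im (F A)) S = Im (F S)"
    by (rule Jordan_decomposition[OF signed_measure_Im[OF F] abs_Re_Im_bounds(2) assms])
  ultimately show ?thesis
    unfolding complex_measure_integral_def * by (simp add: complex_eq_iff)
qed

lemma complex_measure_integral_cong:
  assumes "\<And>x. x \<in> space N \<Longrightarrow> g x = h x"
  shows "complex_measure_integral N F g = complex_measure_integral N F h"
proof -
  have "(LINT x|upper_variation_measure N G. g x) = (LINT x|upper_variation_measure N G. h x)" if "jordan_part G" for G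
    using assms by (intro Bochner_Integration.integral_cong)
      (auto simp: space_upper_variation_measure[OF jordan_part_signed[OF that] jordan_part_bound[OF that]])
  note * = this[OF jordan_parts(1)] this[OF jordan_parts(2)] this[OF jordan_parts(3)] this[OF jordan_parts(4)]
  show ?thesis unfolding complex_measure_integral_def * ..
qed

text \<open>
  The level sets of a simple function form a partition, which is what the variation is a supremum
  over. This is why the total variation appears with constant \<open>1\<close>, although the integral is defined
  by four separate integrals.
\<close>

lemma norm_complex_measure_integral_simple_le:
  assumes s: "simple_function N s" and K: "\<And>x. x \<in> space N \<Longrightarrow> cmod (s x) \<le> K" and K0: "K \<ge> 0"
  shows "cmod (complex_measure_integral N F s) \<le> K * total_variation N F"
proof -
  define T where "T = (\<lambda>y. s -` {y} \<inter> space N)"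
  have finR: "finite (s ` space N)" and T: "\<And>y. T y \<in> sets N"
    using simple_functionD[OF s] by (auto simp: T_def)
  have "complex_measure_integral N F s = complex_measure_integral N F (\<lambda>x. \<Sum>y\<in>s ` space N. y * indicator (T y) x)"
  proof (rule complex_measure_integral_cong)
    fix x assume x: "x \<in> space N"
    have "(\<Sum>y\<in>s ` space N. y * indicator (T y) x) = (\<Sum>y\<in>s ` space N. if y = s x then y else 0)"
      using x by (intro sum.cong) (auto simp: T_def)
    also have "\<dots> = s x" using x finR by simp
    finally show "s x = (\<Sum>y\<in>s ` space N. y * indicator (T y) x)" ..
  qed
  also have "\<dots> = (\<Sum>y\<in>s ` space N. y * F (T y))"
    using T by (subst complex_measure_integral_sum[where K = "\<lambda>_. 1"])
      (auto simp: complex_measure_integral_indicator indicator_def)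
  also have "cmod \<dots> \<le> (\<Sum>y\<in>s ` space N. K * cmod (F (T y)))"
    using K by (intro sum_norm_le) (auto simp: norm_mult intro!: mult_right_mono)
  also have "\<dots> = K * (\<Sum>S\<in>T ` s ` space N. cmod (F S))"
  proof -
    have "inj_on T (s ` space N)" by (auto simp: inj_on_def T_def)
    then show ?thesis by (simp add: sum.reindex sum_distrib_left)
  qed
  also have "\<dots> \<le> K * total_variation N F"
    using finR T K0
    by (intro mult_left_mono sum_norm_le_total_variation) (auto simp: T_def disjoint_def)
  finally show ?thesis .
qed

text \<open>
  Approximation by simple functions. These need not obey the bound \<open>K\<close>, so they are first projected
  onto the disc of radius \<open>K\<close>, which is continuous and does not change the limit.
\<close>

lemma norm_complex_measure_integral_le:
  assumes g: "g \<in> borel_measurable N" and K: "\<And>x. x \<in> space N \<Longrightarrow> cmod (g x) \<le> K"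
    and "K \<ge> 0"
  shows "cmod (complex_measure_integral N F g) \<le> K * total_variation N F"
proof -
  define clip where "clip = closest_point (cball (0::complex) K)"
  have cont: "continuous_on UNIV clip" unfolding clip_def
    using \<open>K \<ge> 0\<close> by (intro continuous_on_closest_point) auto
  have clip_le: "cmod (clip z) \<le> K" for z
    using closest_point_in_set[of "cball (0::complex) K" z] \<open>K \<ge> 0\<close> by (auto simp: clip_def)
  have clip_id: "clip z = z" if "cmod z \<le> K" for z
    using that by (auto simp: clip_def intro: closest_point_self)
  obtain s0 where s0: "\<And>i. simple_function N (s0 i)" "\<And>x. x \<in> space N \<Longrightarrow> (\<lambda>i. s0 i x) \<longlonglongrightarrow> g x"
    using borel_measurable_implies_sequence_metric[OF g, of 0] by blast
  define s where "s = (\<lambda>i x. clip (s0 i x))"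
  have s: "simple_function N (s i)" for i
    using simple_function_compose1[OF s0(1), of clip] by (simp add: s_def)
  have lim: "(\<lambda>i. s i x) \<longlonglongrightarrow> g x" if "x \<in> space N" for x
  proof -
    have "isCont clip (g x)" using cont continuous_on_eq_continuous_at[of UNIV clip] by blast
    from isCont_tendsto_compose[OF this s0(2)[OF that]]
    show ?thesis using clip_id[OF K[OF that]] by (simp add: s_def)
  qed
  have dom: "(\<lambda>i. LINT x|upper_variation_measure N G. s i x) \<longlonglongrightarrow> (LINT x|upper_variation_measure N G. g x)"
    if "jordan_part G" for G
  proof -
    note J = jordan_part_signed[OF that] jordan_part_bound[OF that]
    note sp = sets_upper_variation_measure[OF J] space_upper_variation_measure[OF J]
    interpret finite_measure "upper_variation_measure N G" by (rule finite_upper_variation_measure[OF J])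
    show ?thesis
    proof (rule integral_dominated_convergence[where w = "\<lambda>_. K"])
      show "g \<in> borel_measurable (upper_variation_measure N G)" using g measurable_cong_sets[OF sp(1) refl] by blast
      show "s i \<in> borel_measurable (upper_variation_measure N G)" for i
        using borel_measurable_simple_function[OF s] measurable_cong_sets[OF sp(1) refl] by blast
    qed (use lim clip_le sp(2) in \<open>auto simp: s_def\<close>)
  qed
  have "(\<lambda>i. complex_measure_integral N F (s i)) \<longlonglongrightarrow> complex_measure_integral N F g"
    unfolding complex_measure_integral_def by (intro tendsto_intros dom jordan_parts)
  then have "(\<lambda>i. cmod (complex_measure_integral N F (s i))) \<longlonglongrightarrow> cmod (complex_measure_integral N F g)"
    by (rule tendsto_norm)
  moreover have "cmod (complex_measure_integral N F (s i)) \<le> K * total_variation N F" for i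
    by (rule norm_complex_measure_integral_simple_le[OF s]) (simp_all add: s_def clip_le \<open>K \<ge> 0\<close>)
  ultimately show ?thesis by (meson LIMSEQ_le_const2)
qed

end

section \<open>Mean-square calculus\<close>

lemma square_integrable_measurable [measurable_dest]:
  "square_integrable M X \<Longrightarrow> X \<in> borel_measurable M"
  by (simp add: square_integrable_def)

lemma square_integrable_dominated:
  assumes "X \<in> borel_measurable M" "integrable M Z" "\<And>\<omega>. (cmod (X \<omega>))\<^sup>2 \<le> Z \<omega>"
  shows "square_integrable M X"
proof -
  have "(cmod (X \<omega>))\<^sup>2 \<le> \<bar>Z \<omega>\<bar>" for \<omega> using assms(3) abs_ge_self by (rule order_trans)
  then have "integrable M (\<lambda>\<omega>. (cmod (X \<omega>))\<^sup>2)"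
    by (intro Bochner_Integration.integrable_bound[OF assms(2)]) (use assms(1) in auto)
  then show ?thesis using assms(1) by (simp add: square_integrable_def)
qed

lemma square_integrable_cmult:
  assumes "square_integrable M X"
  shows "square_integrable M (\<lambda>\<omega>. c * X \<omega>)"
  using assms by (auto simp: square_integrable_def norm_mult power_mult_distrib)

lemma norm_add_power2_le:
  fixes x y :: complex
  assumes "\<delta> > 0"
  shows "(cmod (x + y))\<^sup>2 \<le> (1 + \<delta>) * (cmod x)\<^sup>2 + (1 + 1 / \<delta>) * (cmod y)\<^sup>2"
proof -
  have "(cmod (x + y))\<^sup>2 \<le> (cmod x + cmod y)\<^sup>2"
    by (intro power_mono norm_triangle_ineq) auto
  also have "\<dots> = (cmod x)\<^sup>2 + (cmod y)\<^sup>2 + 2 * cmod x * cmod y" by (simp add: power2_sum)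
  also have "2 * cmod x * cmod y \<le> \<delta> * (cmod x)\<^sup>2 + 1 / \<delta> * (cmod y)\<^sup>2"
  proof -
    have "0 \<le> (sqrt \<delta> * cmod x - cmod y / sqrt \<delta>)\<^sup>2" by simp
    also have "\<dots> = \<delta> * (cmod x)\<^sup>2 + 1 / \<delta> * (cmod y)\<^sup>2 - 2 * cmod x * cmod y"
      using assms by (simp add: power2_diff power_mult_distrib power_divide)
    finally show ?thesis by simp
  qed
  finally show ?thesis by (simp add: algebra_simps)
qed

lemma square_integrable_add:
  assumes "square_integrable M X" "square_integrable M Y"
  shows "square_integrable M (\<lambda>\<omega>. X \<omega> + Y \<omega>)"
proof (rule square_integrable_dominated)
  show "integrable M (\<lambda>\<omega>. (1 + 1) * (cmod (X \<omega>))\<^sup>2 + (1 + 1 / 1) * (cmod (Y \<omega>))\<^sup>2)"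
    using assms by (auto simp: square_integrable_def)
  show "(\<lambda>\<omega>. X \<omega> + Y \<omega>) \<in> borel_measurable M" using assms by measurable
qed (rule norm_add_power2_le, simp)

lemma square_integrable_diff:
  assumes "square_integrable M X" "square_integrable M Y"
  shows "square_integrable M (\<lambda>\<omega>. X \<omega> - Y \<omega>)"
  using square_integrable_add[OF assms(1) square_integrable_cmult[OF assms(2), of "-1"]] by simp

lemma square_integrable_sum:
  assumes "\<And>i. i \<in> I \<Longrightarrow> square_integrable M (X i)"
  shows "square_integrable M (\<lambda>\<omega>. \<Sum>i\<in>I. X i \<omega>)"
  using assms
proof (induction I rule: infinite_finite_induct)
  case (insert i I)
  then show ?case by (simp add: square_integrable_add)
qed (auto simp: square_integrable_def)

lemma square_integrableD: "square_integrable M X \<Longrightarrow> integrable M (\<lambda>\<omega>. (cmod (X \<omega>))\<^sup>2)"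
  by (simp add: square_integrable_def)

lemma integrable_mult_cnj:
  assumes "square_integrable M X" "square_integrable M Y"
  shows "integrable M (\<lambda>\<omega>. X \<omega> * cnj (Y \<omega>))"
proof (rule Bochner_Integration.integrable_bound)
  show "integrable M (\<lambda>\<omega>. (cmod (X \<omega>))\<^sup>2 + (cmod (Y \<omega>))\<^sup>2)"
    using assms by (auto dest: square_integrableD)
  have "continuous_on UNIV cnj" by (intro continuous_intros)
  then have [measurable]: "cnj \<in> borel_measurable borel" by (rule borel_measurable_continuous_onI)
  show "(\<lambda>\<omega>. X \<omega> * cnj (Y \<omega>)) \<in> borel_measurable M" using assms by measurable
  have "cmod (X \<omega>) * cmod (Y \<omega>) \<le> (cmod (X \<omega>))\<^sup>2 + (cmod (Y \<omega>))\<^sup>2" for \<omega>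
    using sum_squares_bound[of "cmod (X \<omega>)" "cmod (Y \<omega>)"] mult_nonneg_nonneg[of "cmod (X \<omega>)" "cmod (Y \<omega>)"]
    by (simp del: mult_nonneg_nonneg)
  then show "AE \<omega> in M. norm (X \<omega> * cnj (Y \<omega>)) \<le> norm ((cmod (X \<omega>))\<^sup>2 + (cmod (Y \<omega>))\<^sup>2)"
    by (simp add: norm_mult)
qed

text \<open>
  Cauchy-Schwarz, with each weight split as a product of two square roots.
\<close>

lemma norm_sum_power2_le:
  fixes x :: "'i \<Rightarrow> complex" and c :: "'i \<Rightarrow> complex"
  shows "(cmod (\<Sum>i\<in>I. c i * x i))\<^sup>2 \<le> (\<Sum>i\<in>I. cmod (c i)) * (\<Sum>i\<in>I. cmod (c i) * (cmod (x i))\<^sup>2)"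
proof -
  have "(cmod (\<Sum>i\<in>I. c i * x i))\<^sup>2 \<le> (\<Sum>i\<in>I. sqrt (cmod (c i)) * (sqrt (cmod (c i)) * cmod (x i)))\<^sup>2"
    by (intro power_mono sum_norm_le) (auto simp: norm_mult mult.assoc[symmetric])
  also have "\<dots> \<le> (\<Sum>i\<in>I. (sqrt (cmod (c i)))\<^sup>2) * (\<Sum>i\<in>I. (sqrt (cmod (c i)) * cmod (x i))\<^sup>2)"
    by (rule Cauchy_Schwarz_ineq_sum)
  finally show ?thesis by (simp add: power_mult_distrib)
qed

text \<open>
  The squared Minkowski inequality for weighted sums of random variables with a common bound. It serves
  for increments over a partition, for Riemann sums and for the sinc-weighted sum of averages.
\<close>

lemma second_moment_sum_le:
  assumes X: "\<And>i. i \<in> I \<Longrightarrow> square_integrable M (X i)"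
    and le: "\<And>i. i \<in> I \<Longrightarrow> (LINT \<omega>|M. (cmod (X i \<omega>))\<^sup>2) \<le> V"
  shows "(LINT \<omega>|M. (cmod (\<Sum>i\<in>I. c i * X i \<omega>))\<^sup>2) \<le> (\<Sum>i\<in>I. cmod (c i))\<^sup>2 * V"
proof -
  have "(LINT \<omega>|M. (cmod (\<Sum>i\<in>I. c i * X i \<omega>))\<^sup>2)
      \<le> (LINT \<omega>|M. (\<Sum>i\<in>I. cmod (c i)) * (\<Sum>i\<in>I. cmod (c i) * (cmod (X i \<omega>))\<^sup>2))"
    using X by (intro integral_mono norm_sum_power2_le square_integrableD square_integrable_sum square_integrable_cmult
        integrable_mult_right Bochner_Integration.integrable_sum) auto
  also have "\<dots> = (\<Sum>i\<in>I. cmod (c i)) * (\<Sum>i\<in>I. cmod (c i) * (LINT \<omega>|M. (cmod (X i \<omega>))\<^sup>2))"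
    using X by (simp add: Bochner_Integration.integral_sum square_integrableD)
  also have "\<dots> \<le> (\<Sum>i\<in>I. cmod (c i)) * (\<Sum>i\<in>I. cmod (c i) * V)"
    using le by (intro mult_left_mono sum_mono sum_nonneg) auto
  finally show ?thesis by (simp add: power2_eq_square sum_distrib_right[symmetric] mult.assoc)
qed

lemma second_moment_combination:
  assumes X: "\<And>i. i \<in> I \<Longrightarrow> square_integrable M (X i)"
  shows "complex_of_real (LINT \<omega>|M. (cmod (\<Sum>i\<in>I. c i * X i \<omega>))\<^sup>2)
       = (\<Sum>i\<in>I. \<Sum>j\<in>I. c i * cnj (c j) * (LINT \<omega>|M. X i \<omega> * cnj (X j \<omega>)))"
proof -
  have "complex_of_real (LINT \<omega>|M. (cmod (\<Sum>i\<in>I. c i * X i \<omega>))\<^sup>2)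
      = (LINT \<omega>|M. complex_of_real ((cmod (\<Sum>i\<in>I. c i * X i \<omega>))\<^sup>2))"
    by (rule integral_complex_of_real[symmetric])
  also have "\<dots> = (LINT \<omega>|M. (\<Sum>i\<in>I. \<Sum>j\<in>I. c i * cnj (c j) * (X i \<omega> * cnj (X j \<omega>))))"
    unfolding complex_norm_square by (simp add: sum_product mult_ac)
  also have "\<dots> = (\<Sum>i\<in>I. \<Sum>j\<in>I. c i * cnj (c j) * (LINT \<omega>|M. X i \<omega> * cnj (X j \<omega>)))"
    using integrable_mult_cnj[OF X X] by (simp add: Bochner_Integration.integral_sum)
  finally show ?thesis .
qed

lemma second_moment_increment:
  assumes "square_integrable M (\<xi> x)" "square_integrable M (\<xi> y)"
  shows "complex_of_real (LINT \<omega>|M. (cmod (\<xi> x \<omega> - \<xi> y \<omega>))\<^sup>2)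
      = covariance M \<xi> x x - covariance M \<xi> x y - covariance M \<xi> y x + covariance M \<xi> y y"
  using second_moment_combination[of "{True, False}" M "\<lambda>b. if b then \<xi> x else \<xi> y" "\<lambda>b. if b then 1 else - 1"] assms
  by (simp add: covariance_def algebra_simps)

text \<open>
  The mean value inequality in each variable in turn, first for \<open>u \<mapsto> partial2 g u v\<close>.
\<close>

lemma mixed_difference_bound:
  assumes g: "C2_plane g" and "x \<le> y"
    and S: "\<And>u v. u \<in> {x..y} \<Longrightarrow> v \<in> {x..y} \<Longrightarrow> cmod (mixed_deriv g u v) \<le> S"
  shows "cmod (g y y - g y x - g x y + g x x) \<le> S * (y - x)\<^sup>2"
proof -
  have d2: "((\<lambda>v. g u v) has_vector_derivative partial2 g u v) (at v)" for u v
    using g vector_derivative_works unfolding C2_plane_def C1_plane_def partial2_def by blast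
  have d12: "((\<lambda>u. partial2 g u v) has_vector_derivative mixed_deriv g u v) (at u)" for u v
    using g vector_derivative_works unfolding C2_plane_def C1_plane_def mixed_deriv_def partial1_def by blast
  have inner: "cmod (partial2 g y v - partial2 g x v) \<le> S * (y - x)" if "v \<in> {x..y}" for v
  proof -
    have "cmod (partial2 g y v - partial2 g x v) \<le> S * norm (y - x)"
    proof (rule differentiable_bound[where S = "{x..y}" and f' = "\<lambda>u h. h *\<^sub>R mixed_deriv g u v" and f = "\<lambda>u. partial2 g u v"])
      show "((\<lambda>u. partial2 g u v) has_derivative (\<lambda>h. h *\<^sub>R mixed_deriv g u v)) (at u within {x..y})" for u
        using d12[of v u] unfolding has_vector_derivative_def by (rule has_derivative_at_withinI)
      show "onorm (\<lambda>h. h *\<^sub>R mixed_deriv g u v) \<le> S" if "u \<in> {x..y}" for u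
        using mult_left_mono[OF S[OF that \<open>v \<in> {x..y}\<close>] abs_ge_zero]
        by (intro onorm_le) (simp add: mult.commute)
    qed (use \<open>x \<le> y\<close> in auto)
    then show ?thesis using \<open>x \<le> y\<close> by simp
  qed
  have "cmod ((g y y - g x y) - (g y x - g x x)) \<le> S * (y - x) * norm (y - x)"
  proof (rule differentiable_bound[where S = "{x..y}" and f' = "\<lambda>v h. h *\<^sub>R (partial2 g y v - partial2 g x v)" and f = "\<lambda>v. g y v - g x v"])
    show "((\<lambda>v. g y v - g x v) has_derivative (\<lambda>h. h *\<^sub>R (partial2 g y v - partial2 g x v))) (at v within {x..y})" for v
      using has_vector_derivative_diff[OF d2[of y v] d2[of x v]]
      unfolding has_vector_derivative_def by (rule has_derivative_at_withinI)
    show "onorm (\<lambda>h. h *\<^sub>R (partial2 g y v - partial2 g x v)) \<le> S * (y - x)" if "v \<in> {x..y}" for v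
      using mult_left_mono[OF inner[OF that] abs_ge_zero]
      by (intro onorm_le) (simp add: mult.commute)
  qed (use \<open>x \<le> y\<close> in auto)
  moreover have "(g y y - g x y) - (g y x - g x x) = g y y - g y x - g x y + g x x" by simp
  ultimately show ?thesis using \<open>x \<le> y\<close> by (simp add: power2_eq_square mult.assoc)
qed

text \<open>
  The second moment of \<open>\<xi> b - \<xi> a\<close> is a mixed difference of the covariance over the square on
  \<open>[a, b]\<close>, where only the diagonal values of the mixed derivative are controlled. Cutting \<open>[a, b]\<close>
  into \<open>n\<close> equal pieces keeps to small squares along the diagonal, on which the mixed derivative is
  at most \<open>D + e\<close> by uniform continuity, and \<open>second_moment_sum_le\<close> adds up the pieces.
\<close>

lemma mean_square_Lipschitz_ordered:
  assumes \<xi>: "\<And>t. square_integrable M (\<xi> t)" and B: "C2_plane (covariance M \<xi>)"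
    and D: "\<And>x. cmod (mixed_deriv (covariance M \<xi>) x x) \<le> D" and "a \<le> b"
  shows "(LINT \<omega>|M. (cmod (\<xi> b \<omega> - \<xi> a \<omega>))\<^sup>2) \<le> D * (b - a)\<^sup>2"
proof -
  let ?B = "covariance M \<xi>"
  have main: "(LINT \<omega>|M. (cmod (\<xi> b \<omega> - \<xi> a \<omega>))\<^sup>2) \<le> (D + e) * (b - a)\<^sup>2" if "e > 0" for e
  proof -
    have "continuous_on ({a..b} \<times> {a..b}) (\<lambda>(x, y). mixed_deriv ?B x y)"
      using B unfolding C2_plane_def C1_plane_def mixed_deriv_def by (meson continuous_on_subset subset_UNIV)
    then have "uniformly_continuous_on ({a..b} \<times> {a..b}) (\<lambda>(x, y). mixed_deriv ?B x y)"
      by (rule compact_uniformly_continuous) (intro compact_Times compact_Icc)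
    then obtain d where "d > 0" and d: "\<And>z z'. z \<in> {a..b} \<times> {a..b} \<Longrightarrow> z' \<in> {a..b} \<times> {a..b} \<Longrightarrow> dist z' z < d
        \<Longrightarrow> dist (case z' of (x, y) \<Rightarrow> mixed_deriv ?B x y) (case z of (x, y) \<Rightarrow> mixed_deriv ?B x y) < e"
      using \<open>e > 0\<close> unfolding uniformly_continuous_on_def by metis
    obtain n :: nat where n: "2 * (b - a) / d < real n" using reals_Archimedean2 by blast
    then have n0: "n > 0" using \<open>a \<le> b\<close> \<open>d > 0\<close> by (metis divide_nonneg_pos diff_ge_0_iff_ge less_numeral_extra(3) mult_nonneg_nonneg not_less of_nat_0 zero_le_numeral neq0_conv)
    define h where "h = (b - a) / n"
    have h0: "h \<ge> 0" using \<open>a \<le> b\<close> by (simp add: h_def)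
    have hd: "2 * h < d" using n n0 \<open>d > 0\<close> by (simp add: h_def field_simps)
    define p where "p = (\<lambda>k::nat. a + real k * h)"
    have p0: "p 0 = a" and pn: "p n = b" using n0 by (simp_all add: p_def h_def)
    have p_in: "{p k..p (Suc k)} \<subseteq> {a..b}" if "k < n" for k
    proof -
      have "real (Suc k) * h \<le> real n * h" using that h0 by (intro mult_right_mono) auto
      then show ?thesis using pn h0 by (auto simp: p_def)
    qed
    have inc: "(LINT \<omega>|M. (cmod (\<xi> (p (Suc k)) \<omega> - \<xi> (p k) \<omega>))\<^sup>2) \<le> (D + e) * h\<^sup>2" if "k < n" for k
    proof -
      let ?x = "p k" and ?y = "p (Suc k)"
      have yx: "?y - ?x = h" by (simp add: p_def algebra_simps)
      have "cmod (mixed_deriv ?B u v) \<le> D + e" if uv: "u \<in> {?x..?y}" "v \<in> {?x..?y}" for u v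
      proof -
        have "dist (u, v) (?x, ?x) \<le> \<bar>u - ?x\<bar> + \<bar>v - ?x\<bar>"
          unfolding dist_Pair_Pair dist_real_def using sqrt_sum_squares_le_sum_abs[of "\<bar>u - ?x\<bar>" "\<bar>v - ?x\<bar>"] by simp
        also have "\<dots> < d" using uv yx hd by auto
        finally have "dist (mixed_deriv ?B u v) (mixed_deriv ?B ?x ?x) < e"
          using d[of "(?x, ?x)" "(u, v)"] p_in[OF \<open>k < n\<close>] uv by fastforce
        then show ?thesis using D[of ?x] norm_triangle_sub[of "mixed_deriv ?B u v" "mixed_deriv ?B ?x ?x"]
          by (simp add: dist_norm)
      qed
      then have "cmod (?B ?y ?y - ?B ?y ?x - ?B ?x ?y + ?B ?x ?x) \<le> (D + e) * (?y - ?x)\<^sup>2"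
        using h0 yx by (intro mixed_difference_bound[OF B]) auto
      then have "cmod (complex_of_real (LINT \<omega>|M. (cmod (\<xi> ?y \<omega> - \<xi> ?x \<omega>))\<^sup>2)) \<le> (D + e) * h\<^sup>2"
        unfolding second_moment_increment[of M \<xi>, OF \<xi> \<xi>] yx .
      then show ?thesis unfolding norm_of_real by linarith
    qed
    have "(LINT \<omega>|M. (cmod (\<Sum>k<n. 1 * (\<xi> (p (Suc k)) \<omega> - \<xi> (p k) \<omega>)))\<^sup>2)
        \<le> (\<Sum>k<n. cmod 1)\<^sup>2 * ((D + e) * h\<^sup>2)"
      by (rule second_moment_sum_le) (auto intro: square_integrable_diff \<xi> inc)
    moreover have "(\<Sum>k<n. 1 * (\<xi> (p (Suc k)) \<omega> - \<xi> (p k) \<omega>)) = \<xi> b \<omega> - \<xi> a \<omega>" for \<omega>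
      using sum_lessThan_telescope[of "\<lambda>k. \<xi> (p k) \<omega>" n] by (simp add: p0 pn)
    moreover have "(real n)\<^sup>2 * ((D + e) * h\<^sup>2) = (D + e) * (b - a)\<^sup>2"
      using n0 by (simp add: h_def power_divide)
    ultimately show ?thesis by simp
  qed
  have "((\<lambda>e. (D + e) * (b - a)\<^sup>2) \<longlongrightarrow> (D + 0) * (b - a)\<^sup>2) (at_right 0)" by (intro tendsto_intros)
  then have "(LINT \<omega>|M. (cmod (\<xi> b \<omega> - \<xi> a \<omega>))\<^sup>2) \<le> (D + 0) * (b - a)\<^sup>2"
    by (rule le_limit_at_right_0) (rule main)
  then show ?thesis by simp
qed

lemma mean_square_Lipschitz:
  assumes \<xi>: "\<And>t. square_integrable M (\<xi> t)" and B: "C2_plane (covariance M \<xi>)"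
    and D: "\<And>x. cmod (mixed_deriv (covariance M \<xi>) x x) \<le> D"
  shows "(LINT \<omega>|M. (cmod (\<xi> x \<omega> - \<xi> y \<omega>))\<^sup>2) \<le> D * (x - y)\<^sup>2"
  using mean_square_Lipschitz_ordered[OF assms, of x y] mean_square_Lipschitz_ordered[OF assms, of y x]
  by (cases "x \<le> y") (simp_all add: norm_minus_commute power2_commute)

text \<open>
  Let \<open>R P\<close> be the Riemann sum of a tagged division \<open>P\<close> and \<open>m P\<close> that of \<open>u\<close>. Then
  \<open>R P - m P * \<xi> c\<close> is a sum of increments with total weight \<open>m P\<close>, so that its second moment is
  at most \<open>(m P)\<^sup>2 * D * s\<^sup>2\<close>. Along the division filter, \<open>R P\<close> tends to \<open>Y\<close> in mean square and
  \<open>m P\<close> to \<open>1\<close>. The parameter \<open>\<delta>\<close> stands in for the triangle inequality of the mean-square norm.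
\<close>

lemma mean_square_average_error:
  assumes \<xi>: "\<And>t. square_integrable M (\<xi> t)"
    and Lip: "\<And>x y. (LINT \<omega>|M. (cmod (\<xi> x \<omega> - \<xi> y \<omega>))\<^sup>2) \<le> D * (x - y)\<^sup>2" and "D \<ge> 0"
    and Y: "has_ms_integral M (\<lambda>x \<omega>. \<xi> x \<omega> * of_real (u x)) Y {a..b}"
    and u0: "\<And>x. 0 \<le> u x" and u1: "(u has_integral 1) {a..b}"
    and s: "\<And>x. x \<in> {a..b} \<Longrightarrow> \<bar>x - c\<bar> \<le> s"
  shows "(LINT \<omega>|M. (cmod (\<xi> c \<omega> - Y \<omega>))\<^sup>2) \<le> D * s\<^sup>2"
proof -
  let ?F = "division_filter {a..b}"
  have ne: "?F \<noteq> bot" using division_filter_not_empty[of a b] by simp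
  have Ysq: "square_integrable M Y" using Y by (simp add: has_ms_integral_def)
  define R where "R = (\<lambda>P \<omega>. \<Sum>(x, K :: real set)\<in>P. measure lborel K *\<^sub>R (\<xi> x \<omega> * of_real (u x)))"
  define m where "m = (\<lambda>P. \<Sum>(x, K :: real set)\<in>P. measure lborel K * u x)"
  have limR: "((\<lambda>P. LINT \<omega>|M. (cmod (R P \<omega> - Y \<omega>))\<^sup>2) \<longlongrightarrow> 0) ?F"
    using Y by (simp add: has_ms_integral_def R_def)
  have limm: "(m \<longlongrightarrow> 1) ?F"
    using u1 has_integral_cbox[of u 1 a b] by (simp add: m_def)
  have Ralt: "R P \<omega> = (\<Sum>z\<in>P. of_real (measure lborel (snd z) * u (fst z)) * \<xi> (fst z) \<omega>)" for P \<omega>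
    by (simp add: R_def case_prod_unfold scaleR_conv_of_real mult_ac)
  have Rsq: "square_integrable M (R P)" for P
    unfolding Ralt[abs_def] by (intro square_integrable_sum square_integrable_cmult \<xi>)
  define E where "E = (LINT \<omega>|M. (cmod (\<xi> c \<omega> - Y \<omega>))\<^sup>2)"
  define V where "V = (LINT \<omega>|M. (cmod (\<xi> c \<omega>))\<^sup>2)"
  have main: "E \<le> (1 + \<delta>) * (D * s\<^sup>2)" if "\<delta> > 0" for \<delta>
  proof -
    define bnd where "bnd = (\<lambda>P. (1 + \<delta>) * ((m P)\<^sup>2 * (D * s\<^sup>2))
        + (1 + 1 / \<delta>) * (2 * (LINT \<omega>|M. (cmod (R P \<omega> - Y \<omega>))\<^sup>2) + 2 * ((m P - 1)\<^sup>2 * V)))"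
    have "E \<le> bnd P" if P: "P tagged_division_of {a..b}" for P
    proof -
      have Pin: "x \<in> {a..b}" if "(x, K) \<in> P" for x K
        using P that by blast
      have Z: "R P \<omega> - of_real (m P) * \<xi> c \<omega> = (\<Sum>z\<in>P. of_real (measure lborel (snd z) * u (fst z)) * (\<xi> (fst z) \<omega> - \<xi> c \<omega>))" for \<omega>
        by (simp add: Ralt m_def case_prod_unfold sum_subtractf sum_distrib_right right_diff_distrib)
      have m1: "(\<Sum>z\<in>P. cmod (of_real (measure lborel (snd z) * u (fst z)))) = m P"
        using u0 by (simp add: m_def case_prod_unfold norm_mult)
      have Zle: "(LINT \<omega>|M. (cmod (R P \<omega> - of_real (m P) * \<xi> c \<omega>))\<^sup>2) \<le> (m P)\<^sup>2 * (D * s\<^sup>2)"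
        unfolding Z
      proof (subst m1[symmetric], rule second_moment_sum_le)
        fix z assume z: "z \<in> P"
        show "square_integrable M (\<lambda>\<omega>. \<xi> (fst z) \<omega> - \<xi> c \<omega>)" by (intro square_integrable_diff \<xi>)
        have "(fst z - c)\<^sup>2 \<le> s\<^sup>2"
          using s[OF Pin[of "fst z" "snd z"]] z by (simp add: abs_le_square_iff[symmetric])
        then show "(LINT \<omega>|M. (cmod (\<xi> (fst z) \<omega> - \<xi> c \<omega>))\<^sup>2) \<le> D * s\<^sup>2"
          using Lip[of "fst z" c] \<open>D \<ge> 0\<close> by (meson mult_left_mono order_trans)
      qed
      have pw: "(cmod (\<xi> c \<omega> - Y \<omega>))\<^sup>2 \<le> (1 + \<delta>) * (cmod (R P \<omega> - of_real (m P) * \<xi> c \<omega>))\<^sup>2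
          + (1 + 1 / \<delta>) * (2 * (cmod (R P \<omega> - Y \<omega>))\<^sup>2 + 2 * ((m P - 1)\<^sup>2 * (cmod (\<xi> c \<omega>))\<^sup>2))" for \<omega>
      proof -
        let ?A = "R P \<omega> - of_real (m P) * \<xi> c \<omega>" and ?A2 = "R P \<omega> - Y \<omega>" and ?A3 = "of_real (m P - 1) * \<xi> c \<omega>"
        have "\<xi> c \<omega> - Y \<omega> = - ?A + (?A2 + - ?A3)" by (simp add: algebra_simps)
        then have "(cmod (\<xi> c \<omega> - Y \<omega>))\<^sup>2 \<le> (1 + \<delta>) * (cmod (- ?A))\<^sup>2 + (1 + 1 / \<delta>) * (cmod (?A2 + - ?A3))\<^sup>2"
          using norm_add_power2_le[OF \<open>\<delta> > 0\<close>] by metis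
        also have "(cmod (?A2 + - ?A3))\<^sup>2 \<le> 2 * (cmod ?A2)\<^sup>2 + 2 * (cmod (- ?A3))\<^sup>2"
          using norm_add_power2_le[of 1 ?A2 "- ?A3"] by simp
        also have "(cmod (- ?A3))\<^sup>2 = (m P - 1)\<^sup>2 * (cmod (\<xi> c \<omega>))\<^sup>2"
          unfolding norm_minus_cancel norm_mult norm_of_real power_mult_distrib power2_abs ..
        finally show ?thesis
          using \<open>\<delta> > 0\<close> by (simp add: mult_left_mono norm_minus_commute[of "R P \<omega>" "of_real (m P) * \<xi> c \<omega>"] del: of_real_diff)
      qed
      have "E \<le> (LINT \<omega>|M. (1 + \<delta>) * (cmod (R P \<omega> - of_real (m P) * \<xi> c \<omega>))\<^sup>2
          + (1 + 1 / \<delta>) * (2 * (cmod (R P \<omega> - Y \<omega>))\<^sup>2 + 2 * ((m P - 1)\<^sup>2 * (cmod (\<xi> c \<omega>))\<^sup>2)))"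
        unfolding E_def
        by (intro integral_mono pw square_integrableD square_integrable_diff \<xi> Ysq Bochner_Integration.integrable_add
            integrable_mult_right Rsq square_integrable_cmult)
      also have "\<dots> = (1 + \<delta>) * (LINT \<omega>|M. (cmod (R P \<omega> - of_real (m P) * \<xi> c \<omega>))\<^sup>2)
          + (1 + 1 / \<delta>) * (2 * (LINT \<omega>|M. (cmod (R P \<omega> - Y \<omega>))\<^sup>2) + 2 * ((m P - 1)\<^sup>2 * V))"
        using square_integrableD[OF square_integrable_diff[OF Rsq square_integrable_cmult[OF \<xi>]]]
          square_integrableD[OF square_integrable_diff[OF Rsq Ysq]] square_integrableD[OF \<xi>]
        by (simp add: V_def)
      also have "\<dots> \<le> bnd P"
        using Zle \<open>\<delta> > 0\<close> unfolding bnd_def by (intro add_right_mono mult_left_mono) auto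
      finally show ?thesis .
    qed
    then have "eventually (\<lambda>P. E \<le> bnd P) ?F"
      using eventually_division_filter_tagged_division[of "{a..b}"] by (auto elim: eventually_mono)
    moreover have "(bnd \<longlongrightarrow> (1 + \<delta>) * (1\<^sup>2 * (D * s\<^sup>2)) + (1 + 1 / \<delta>) * (2 * 0 + 2 * ((1 - 1)\<^sup>2 * V))) ?F"
      unfolding bnd_def by (intro tendsto_intros limm limR)
    ultimately have "E \<le> (1 + \<delta>) * (1\<^sup>2 * (D * s\<^sup>2)) + (1 + 1 / \<delta>) * (2 * 0 + 2 * ((1 - 1)\<^sup>2 * V))"
      using tendsto_lowerbound ne by blast
    then show ?thesis by simp
  qed
  have "((\<lambda>\<delta>. (1 + \<delta>) * (D * s\<^sup>2)) \<longlongrightarrow> (1 + 0) * (D * s\<^sup>2)) (at_right 0)" by (intro tendsto_intros)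
  then have "E \<le> (1 + 0) * (D * s\<^sup>2)"
    by (rule le_limit_at_right_0) (rule main)
  then show ?thesis by (simp add: E_def)
qed

section \<open>Sums of sinc values and the averaging width\<close>

lemma conjugate_exponent_gt_1:
  fixes p q :: real
  assumes "1 < p" "1 / p + 1 / q = 1"
  shows "1 < q"
proof -
  have "1 / q = 1 - 1 / p" using assms(2) by linarith
  then have "0 < 1 / q" "1 / q < 1" using assms(1) by simp_all
  then show ?thesis by (simp add: field_simps)
qed

text \<open>
  The square of Hoelder's inequality against the constant sequence \<open>1\<close>, from Jensen's inequality for
  \<open>x powr q\<close>.
\<close>

lemma sum_power2_le_sum_powr:
  fixes s :: "'i \<Rightarrow> real"
  assumes "finite I" "\<And>i. i \<in> I \<Longrightarrow> 0 \<le> s i" "1 < p" "1 / p + 1 / q = 1" "real (card I) \<le> m"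
  shows "(\<Sum>i\<in>I. s i)\<^sup>2 \<le> (\<Sum>i\<in>I. s i powr q) powr (2 / q) * m powr (2 / p)"
proof -
  have iq: "1 / q = 1 - 1 / p" using assms(4) by linarith
  have q: "q > 1" by (rule conjugate_exponent_gt_1[OF assms(3,4)])
  \<comment> \<open>Convexity of \<open>x powr q\<close> is used on the open half line, so vanishing terms are left out.\<close>
  define J where "J = {i \<in> I. s i > 0}"
  have finJ: "finite J" and JI: "J \<subseteq> I" using assms(1) by (auto simp: J_def)
  have sumJ: "(\<Sum>i\<in>I. s i) = (\<Sum>i\<in>J. s i)"
    using assms(1,2) by (intro sum.mono_neutral_right) (auto simp: J_def not_less intro: antisym)
  have sumqJ: "(\<Sum>i\<in>J. s i powr q) \<le> (\<Sum>i\<in>I. s i powr q)"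
    using assms(1) JI by (intro sum_mono2) auto
  show ?thesis
  proof (cases "J = {}")
    case True
    then show ?thesis by (simp add: sumJ)
  next
    case False
    define k where "k = real (card J)"
    have k: "k > 0" using False finJ by (simp add: k_def card_gt_0_iff)
    have km: "k \<le> m" using card_mono[OF assms(1) JI] assms(5) unfolding k_def by linarith
    define T where "T = (\<Sum>i\<in>J. s i powr q)"
    have T0: "T \<ge> 0" unfolding T_def by (intro sum_nonneg) auto
    have "(\<Sum>i\<in>J. (1 / k) *\<^sub>R s i) powr q \<le> (\<Sum>i\<in>J. 1 / k * s i powr q)"
    proof (rule convex_on_sum[OF finJ False powr_convex])
      show "(\<Sum>i\<in>J. 1 / k) = 1" using k by (simp add: k_def)
    qed (use q k in \<open>auto simp: J_def\<close>)
    then have "((\<Sum>i\<in>J. s i) / k) powr q \<le> T / k"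
      by (simp add: T_def sum_divide_distrib)
    then have "(((\<Sum>i\<in>J. s i) / k) powr q) powr (1 / q) \<le> (T / k) powr (1 / q)"
      using q by (intro powr_mono2) auto
    moreover have S0: "(\<Sum>i\<in>J. s i) \<ge> 0" by (intro sum_nonneg) (auto simp: J_def)
    ultimately have "(\<Sum>i\<in>J. s i) / k \<le> (T / k) powr (1 / q)"
      using q k by (simp add: powr_powr)
    also have "\<dots> = T powr (1 / q) / k powr (1 / q)" using T0 k by (simp add: powr_divide)
    finally have "(\<Sum>i\<in>J. s i) \<le> T powr (1 / q) * (k / k powr (1 / q))"
      using k by (simp add: field_simps)
    also have "k / k powr (1 / q) = k powr (1 / p)"
      using k unfolding iq by (simp add: powr_diff)
    finally have "(\<Sum>i\<in>J. s i)\<^sup>2 \<le> (T powr (1 / q) * k powr (1 / p))\<^sup>2"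
      using S0 by (intro power_mono) auto
    also have "\<dots> = T powr (2 / q) * k powr (2 / p)"
      using powr_power[of T "1 / q" 2] powr_power[of k "1 / p" 2] k
      by (cases "T = 0") (simp_all add: power_mult_distrib)
    also have "\<dots> \<le> (\<Sum>i\<in>I. s i powr q) powr (2 / q) * m powr (2 / p)"
      using T0 sumqJ k km q \<open>1 < p\<close> unfolding T_def by (intro mult_mono powr_mono2) auto
    finally show ?thesis unfolding sumJ .
  qed
qed

lemma abs_sinc_le_1: "\<bar>sinc x\<bar> \<le> (1 :: real)"
  using abs_sin_x_le_abs_x[of x] by (simp add: divide_le_eq)

text \<open>
  With \<open>n0 * pi\<close> the multiple of \<open>pi\<close> nearest to \<open>x\<close>, the \<open>k\<close>-th next multiple on either side has
  distance at least \<open>(2 * k - 1) * pi / 2\<close> from \<open>x\<close>. The term \<open>n0\<close> contributes at most \<open>1\<close> and each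
  side at most \<open>(2 * \<bar>sin x\<bar> / pi) powr q\<close> times the sum over odd integers.
\<close>

lemma sum_sinc_powr_le:
  assumes "q > 1" "finite J"
  shows "(\<Sum>n\<in>J. \<bar>sinc (x - of_int n * pi)\<bar> powr q)
       \<le> 1 + 2 powr (q + 1) * \<bar>sin x\<bar> powr q / pi powr q * odd_zeta q"
proof -
  define n0 where "n0 = round (x / pi)"
  define b where "b = (\<lambda>k::nat. (2 * \<bar>sin x\<bar> / pi) powr q * (1 / (2 * real (Suc k) - 1) powr q))"
  have near: "\<bar>x - of_int n0 * pi\<bar> \<le> pi / 2"
  proof -
    have "\<bar>of_int n0 - x / pi\<bar> \<le> 1 / 2" unfolding n0_def by (rule of_int_round_abs_le)
    then have "\<bar>of_int n0 - x / pi\<bar> * pi \<le> 1 / 2 * pi" by (intro mult_right_mono) auto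
    also have "\<bar>of_int n0 - x / pi\<bar> * pi = \<bar>(of_int n0 - x / pi) * pi\<bar>" by (simp add: abs_mult)
    also have "(of_int n0 - x / pi) * pi = of_int n0 * pi - x" by (simp add: field_simps)
    finally show ?thesis by (simp add: abs_minus_commute)
  qed
  have abs_sin: "\<bar>sin (x - of_int n * pi)\<bar> = \<bar>sin x\<bar>" for n :: int
  proof -
    have s: "sin (of_int n * pi) = 0" using sin_zero_iff_int2[of "of_int n * pi"] by auto
    then have "(cos (of_int n * pi))\<^sup>2 = 1" using cos_squared_eq[of "of_int n * pi"] by simp
    then have "\<bar>cos (of_int n * pi)\<bar> = 1" by (auto simp: power2_eq_1_iff)
    then show ?thesis using s by (simp add: sin_diff abs_mult)
  qed
  have far: "\<bar>sinc (x - of_int n * pi)\<bar> powr q \<le> b k" if n: "\<bar>n - n0\<bar> = int (Suc k)" for n k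
  proof -
    have "\<bar>real_of_int n - of_int n0\<bar> = real (Suc k)"
      using n by (metis of_int_abs of_int_diff of_int_of_nat_eq)
    then have "\<bar>(real_of_int n - of_int n0) * pi\<bar> = real (Suc k) * pi" by (simp add: abs_mult)
    then have d: "\<bar>x - of_int n * pi\<bar> \<ge> (2 * real (Suc k) - 1) * pi / 2"
      using near abs_triangle_ineq2[of "(real_of_int n - of_int n0) * pi" "x - of_int n0 * pi"]
      by (simp add: algebra_simps abs_minus_commute)
    have pos: "(2 * real (Suc k) - 1) * pi / 2 > 0" by simp
    then have apos: "\<bar>x - of_int n * pi\<bar> > 0" using d by linarith
    then have "\<bar>sinc (x - of_int n * pi)\<bar> = \<bar>sin x\<bar> / \<bar>x - of_int n * pi\<bar>"
      using abs_sin[of n] apos by (simp add: abs_divide)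
    also have "\<dots> \<le> \<bar>sin x\<bar> / ((2 * real (Suc k) - 1) * pi / 2)"
      using d by (intro divide_left_mono mult_pos_pos apos pos abs_ge_zero)
    also have "\<dots> = (2 * \<bar>sin x\<bar> / pi) * (1 / (2 * real (Suc k) - 1))" by (simp add: mult.commute)
    finally have "\<bar>sinc (x - of_int n * pi)\<bar> powr q \<le> ((2 * \<bar>sin x\<bar> / pi) * (1 / (2 * real (Suc k) - 1))) powr q"
      using \<open>q > 1\<close> by (intro powr_mono2) auto
    also have "\<dots> = b k" unfolding b_def by (subst powr_mult) (simp_all add: powr_divide)
    finally show ?thesis .
  qed
  have summ0: "summable (\<lambda>n. 1 / (2 * real (Suc n) - 1) powr q)"
  proof (rule summable_comparison_test')
    show "summable (\<lambda>n. real (Suc n) powr (- q))"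
      using \<open>q > 1\<close> by (subst summable_Suc_iff) (simp add: summable_real_powr_iff)
    show "norm (1 / (2 * real (Suc n) - 1) powr q) \<le> real (Suc n) powr (- q)" for n
    proof -
      have "real (Suc n) powr q \<le> (2 * real (Suc n) - 1) powr q"
        using \<open>q > 1\<close> by (intro powr_mono2) auto
      then show ?thesis by (simp add: powr_minus field_simps)
    qed
  qed
  have b_sums: "b sums ((2 * \<bar>sin x\<bar> / pi) powr q * odd_zeta q)"
    unfolding b_def odd_zeta_def by (intro sums_mult summable_sums summ0)
  have b0: "b k \<ge> 0" for k by (simp add: b_def)
  have half: "(\<Sum>n\<in>H. \<bar>sinc (x - of_int n * pi)\<bar> powr q) \<le> (2 * \<bar>sin x\<bar> / pi) powr q * odd_zeta q"
    if H: "finite H" "inj_on (\<lambda>n. nat (\<bar>n - n0\<bar> - 1)) H" "n0 \<notin> H" for H :: "int set"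
  proof -
    have "(\<Sum>n\<in>H. \<bar>sinc (x - of_int n * pi)\<bar> powr q) \<le> (\<Sum>n\<in>H. b (nat (\<bar>n - n0\<bar> - 1)))"
    proof (intro sum_mono far)
      fix n assume "n \<in> H"
      then have "n \<noteq> n0" using H(3) by auto
      then show "\<bar>n - n0\<bar> = int (Suc (nat (\<bar>n - n0\<bar> - 1)))" by simp
    qed
    also have "\<dots> = (\<Sum>k\<in>(\<lambda>n. nat (\<bar>n - n0\<bar> - 1)) ` H. b k)"
      using H(2) by (simp add: sum.reindex)
    also have "\<dots> \<le> (\<Sum>k. b k)"
      using b_sums b0 H(1) by (intro sum_le_suminf) (auto simp: sums_iff)
    also have "\<dots> = (2 * \<bar>sin x\<bar> / pi) powr q * odd_zeta q" using b_sums by (simp add: sums_iff)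
    finally show ?thesis .
  qed
  define s where "s = (\<lambda>n::int. \<bar>sinc (x - of_int n * pi)\<bar> powr q)"
  have split: "J = (J \<inter> {n0}) \<union> ((J \<inter> {n0<..}) \<union> (J \<inter> {..<n0}))" by auto
  have "sum s J = sum s (J \<inter> {n0}) + (sum s (J \<inter> {n0<..}) + sum s (J \<inter> {..<n0}))"
    using \<open>finite J\<close> by (subst split, subst sum.union_disjoint, auto, subst sum.union_disjoint, auto)
  moreover have "sum s (J \<inter> {n0}) \<le> 1"
  proof -
    have "s n0 \<le> 1"
      unfolding s_def by (rule powr_le1) (use \<open>q > 1\<close> in simp, unfold abs_abs, rule abs_sinc_le_1)
    then show ?thesis by (cases "n0 \<in> J") auto
  qed
  moreover have "sum s (J \<inter> {n0<..}) \<le> (2 * \<bar>sin x\<bar> / pi) powr q * odd_zeta q"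
    unfolding s_def using \<open>finite J\<close> by (intro half) (auto simp: inj_on_def)
  moreover have "sum s (J \<inter> {..<n0}) \<le> (2 * \<bar>sin x\<bar> / pi) powr q * odd_zeta q"
    unfolding s_def using \<open>finite J\<close> by (intro half) (auto simp: inj_on_def)
  moreover have "2 powr (q + 1) * \<bar>sin x\<bar> powr q / pi powr q * odd_zeta q = 2 * ((2 * \<bar>sin x\<bar> / pi) powr q * odd_zeta q)"
    by (simp add: powr_mult powr_divide powr_add)
  ultimately show ?thesis unfolding s_def by linarith
qed

lemma card_sampling_indices_le: "real (card (sampling_indices w N t)) \<le> 2 * real N + 1"
proof -
  have "of_int (\<lfloor>t * w / pi + N\<rfloor> - \<lceil>t * w / pi - N\<rceil> + 1) \<le> 2 * real N + 1" by linarith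
  then show ?thesis unfolding sampling_indices_eq by simp
qed

lemma sum_abs_sinc_power2_le:
  assumes "1 < p" "1 / p + 1 / q = 1"
  shows "(\<Sum>n\<in>sampling_indices w N t. \<bar>sinc (w * t - of_int n * pi)\<bar>)\<^sup>2
       \<le> averaging_const w q t * (2 * real N + 1) powr (2 / p)"
proof -
  have q: "q > 1" by (rule conjugate_exponent_gt_1[OF assms])
  have fin: "finite (sampling_indices w N t)" by (simp add: sampling_indices_eq)
  have "(\<Sum>n\<in>sampling_indices w N t. \<bar>sinc (w * t - of_int n * pi)\<bar>)\<^sup>2
      \<le> (\<Sum>n\<in>sampling_indices w N t. \<bar>sinc (w * t - of_int n * pi)\<bar> powr q) powr (2 / q) * (2 * real N + 1) powr (2 / p)"
    by (rule sum_power2_le_sum_powr[OF fin _ assms card_sampling_indices_le]) simp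
  also have "\<dots> \<le> averaging_const w q t * (2 * real N + 1) powr (2 / p)"
    unfolding averaging_const_def
    using q sum_sinc_powr_le[OF q fin] by (intro mult_right_mono powr_mono2 sum_nonneg) auto
  finally show ?thesis .
qed

text \<open>
  For \<open>N \<ge> 1\<close> the index sets contain the nearest integer to \<open>t * w / pi\<close>, so the maxima are over
  nonempty sets and the common bound \<open>pi / (2 * w)\<close> makes the supremum a proper one.
\<close>

lemma averaging_width_upper:
  assumes av: "averaging_functions w \<sigma>' \<sigma>'' u" and "N \<ge> 1" and n: "n \<in> sampling_indices w N t"
  shows "max (\<sigma>' t n) (\<sigma>'' t n) \<le> averaging_width w N \<sigma>' \<sigma>''"
proof -
  have fin: "finite (sampling_indices w N t)" for t by (simp add: sampling_indices_eq)
  have ne: "sampling_indices w N t \<noteq> {}" for t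
  proof -
    have "round (t * w / pi) \<in> sampling_indices w N t"
      using of_int_round_abs_le[of "t * w / pi"] \<open>N \<ge> 1\<close>
      by (simp add: sampling_indices_def abs_minus_commute)
    then show ?thesis by auto
  qed
  have "max (\<sigma>' t n) (\<sigma>'' t n) \<le> (MAX n\<in>sampling_indices w N t. max (\<sigma>' t n) (\<sigma>'' t n))"
    using n fin by (intro Max_ge) auto
  also have "\<dots> \<le> averaging_width w N \<sigma>' \<sigma>''"
    unfolding averaging_width_def
  proof (rule cSUP_upper)
    show "bdd_above (range (\<lambda>t. MAX n\<in>sampling_indices w N t. max (\<sigma>' t n) (\<sigma>'' t n)))"
      using av fin ne by (intro bdd_aboveI2[where M = "pi / (2 * w)"]) (auto simp: averaging_functions_def)
  qed simp
  finally show ?thesis .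
qed

section \<open>Error bounds for the process\<close>

text \<open>
  Expanding the square gives covariances, and these are integrals of products of kernel functions; by
  linearity the sum is the integral of \<open>G l * cnj (G m)\<close>, where \<open>G\<close> is the given combination of
  kernel functions.
\<close>

lemma piranashvili_second_moment_le:
  assumes P: "piranashvili_process M L f F \<xi>"
    and K: "\<And>t l. l \<in> space L \<Longrightarrow> cmod (f (of_real t) l) \<le> K"
    and "finite I" and R: "\<And>l. l \<in> space L \<Longrightarrow> cmod (\<Sum>i\<in>I. c i * f (of_real (\<tau> i)) l) \<le> R" "R \<ge> 0"
  shows "(LINT \<omega>|M. (cmod (\<Sum>i\<in>I. c i * \<xi> (\<tau> i) \<omega>))\<^sup>2) \<le> R\<^sup>2 * total_variation (L \<Otimes>\<^sub>M L) F"
proof -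
  have \<xi>: "square_integrable M (\<xi> t)" for t using P by (simp add: piranashvili_process_def)
  have F: "complex_measure (L \<Otimes>\<^sub>M L) F" using P by (simp add: piranashvili_process_def)
  have var: "variation (L \<Otimes>\<^sub>M L) F (space (L \<Otimes>\<^sub>M L)) < \<infinity>"
    using P by (simp add: piranashvili_process_def space_pair_measure)
  have fm [measurable]: "f (of_real t) \<in> borel_measurable L" for t
    using P by (simp add: piranashvili_process_def)
  have cov: "covariance M \<xi> t s = complex_measure_integral (L \<Otimes>\<^sub>M L) F (\<lambda>(l, m). f (of_real t) l * cnj (f (of_real s) m))" for t s
    using P by (simp add: piranashvili_process_def)
  have "continuous_on UNIV cnj" by (intro continuous_intros)
  then have [measurable]: "cnj \<in> borel_measurable borel" by (rule borel_measurable_continuous_onI)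
  define h where "h = (\<lambda>t s (l, m). f (of_real t) l * cnj (f (of_real s) m))"
  have hm: "h t s \<in> borel_measurable (L \<Otimes>\<^sub>M L)" for t s
    unfolding h_def case_prod_unfold by measurable
  have hb: "cmod (h t s x) \<le> K * K" if "x \<in> space (L \<Otimes>\<^sub>M L)" for t s x
    using that K[of "fst x" t] K[of "snd x" s] order_trans[OF norm_ge_zero K[of "fst x" t]]
    by (auto simp: h_def space_pair_measure norm_mult intro!: mult_mono)
  define G where "G = (\<lambda>l. \<Sum>i\<in>I. c i * f (of_real (\<tau> i)) l)"
  have GG: "(\<Sum>ij\<in>I \<times> I. c (fst ij) * cnj (c (snd ij)) * h (\<tau> (fst ij)) (\<tau> (snd ij)) x) = G (fst x) * cnj (G (snd x))" for x
    by (simp add: G_def sum_product sum.cartesian_product h_def case_prod_unfold mult_ac)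
  have "complex_of_real (LINT \<omega>|M. (cmod (\<Sum>i\<in>I. c i * \<xi> (\<tau> i) \<omega>))\<^sup>2)
      = (\<Sum>i\<in>I. \<Sum>j\<in>I. c i * cnj (c j) * covariance M \<xi> (\<tau> i) (\<tau> j))"
    using second_moment_combination[of I M "\<lambda>i. \<xi> (\<tau> i)" c] \<xi> by (simp add: covariance_def)
  also have "\<dots> = (\<Sum>ij\<in>I \<times> I. c (fst ij) * cnj (c (snd ij)) * complex_measure_integral (L \<Otimes>\<^sub>M L) F (h (\<tau> (fst ij)) (\<tau> (snd ij))))"
    by (simp add: cov sum.cartesian_product h_def case_prod_unfold)
  also have "\<dots> = complex_measure_integral (L \<Otimes>\<^sub>M L) F
      (\<lambda>x. \<Sum>ij\<in>I \<times> I. c (fst ij) * cnj (c (snd ij)) * h (\<tau> (fst ij)) (\<tau> (snd ij)) x)"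
    by (rule complex_measure_integral_sum[OF F var hm hb, symmetric])
  also have "\<dots> = complex_measure_integral (L \<Otimes>\<^sub>M L) F (\<lambda>x. G (fst x) * cnj (G (snd x)))"
    unfolding GG ..
  finally have eq: "complex_of_real (LINT \<omega>|M. (cmod (\<Sum>i\<in>I. c i * \<xi> (\<tau> i) \<omega>))\<^sup>2)
      = complex_measure_integral (L \<Otimes>\<^sub>M L) F (\<lambda>x. G (fst x) * cnj (G (snd x)))" .
  have "cmod (complex_measure_integral (L \<Otimes>\<^sub>M L) F (\<lambda>x. G (fst x) * cnj (G (snd x)))) \<le> R\<^sup>2 * total_variation (L \<Otimes>\<^sub>M L) F"
  proof (rule norm_complex_measure_integral_le[OF F var])
    show "(\<lambda>x. G (fst x) * cnj (G (snd x))) \<in> borel_measurable (L \<Otimes>\<^sub>M L)"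
      unfolding G_def by measurable
    show "cmod (G (fst x) * cnj (G (snd x))) \<le> R\<^sup>2" if "x \<in> space (L \<Otimes>\<^sub>M L)" for x
      using that R unfolding norm_mult complex_mod_cnj power2_eq_square
      by (intro mult_mono) (auto simp: G_def space_pair_measure)
  qed simp
  then show ?thesis unfolding eq[symmetric] norm_of_real by linarith
qed

text \<open>
  By monotone convergence the series \<open>(\<Sum>n. \<bar>X n\<bar>\<^sup>2)\<close> has finite expectation, so it converges almost
  surely and its terms tend to \<open>0\<close>.
\<close>

lemma AE_tendsto_0_if_summable_second_moments:
  assumes X: "\<And>n. square_integrable M (X n)" and s: "summable (\<lambda>n. LINT \<omega>|M. (cmod (X n \<omega>))\<^sup>2)"
  shows "AE \<omega> in M. (\<lambda>n. X n \<omega>) \<longlonglongrightarrow> 0"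
proof -
  have [measurable]: "X n \<in> borel_measurable M" for n using X by (simp add: square_integrable_def)
  have "(\<integral>\<^sup>+\<omega>. (\<Sum>n. ennreal ((cmod (X n \<omega>))\<^sup>2)) \<partial>M) = (\<Sum>n. \<integral>\<^sup>+\<omega>. ennreal ((cmod (X n \<omega>))\<^sup>2) \<partial>M)"
    by (rule nn_integral_suminf) measurable
  also have "\<dots> = (\<Sum>n. ennreal (LINT \<omega>|M. (cmod (X n \<omega>))\<^sup>2))"
    using X by (simp add: nn_integral_eq_integral square_integrable_def)
  also have "\<dots> = ennreal (\<Sum>n. LINT \<omega>|M. (cmod (X n \<omega>))\<^sup>2)"
    by (rule suminf_ennreal2[OF _ s]) simp
  finally have "(\<integral>\<^sup>+\<omega>. (\<Sum>n. ennreal ((cmod (X n \<omega>))\<^sup>2)) \<partial>M) \<noteq> \<infinity>" by simp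
  then have "AE \<omega> in M. (\<Sum>n. ennreal ((cmod (X n \<omega>))\<^sup>2)) \<noteq> \<infinity>"
    by (intro nn_integral_noteq_infinite) measurable
  then show ?thesis
  proof eventually_elim
    case (elim \<omega>)
    then have "summable (\<lambda>n. (cmod (X n \<omega>))\<^sup>2)"
      by (intro summable_suminf_not_top) auto
    then have "(\<lambda>n. sqrt ((cmod (X n \<omega>))\<^sup>2)) \<longlonglongrightarrow> sqrt 0"
      by (intro tendsto_real_sqrt summable_LIMSEQ_zero)
    then show ?case by (simp add: tendsto_norm_zero_iff)
  qed
qed

text \<open>
  The powers \<open>N powr (- 2 / p)\<close> and \<open>(2 * N + 1) powr (2 / p)\<close> cancel up to the factor
  \<open>3 powr (2 / p)\<close>. The case \<open>e = 0\<close> is used for mean-square convergence, \<open>e = 1 / 2 + \<epsilon>\<close> for almost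
  sure convergence.
\<close>

lemma width_term_le:
  assumes "N \<ge> (1 :: nat)" "p > 0" "x \<ge> 0" "x \<le> c * real N powr (- 1 / p - e)"
  shows "x\<^sup>2 * (2 * real N + 1) powr (2 / p) \<le> 3 powr (2 / p) * c\<^sup>2 * real N powr (- 2 * e)"
proof -
  have "x\<^sup>2 \<le> (c * real N powr (- 1 / p - e))\<^sup>2"
    using assms by (intro power_mono) auto
  also have "\<dots> = c\<^sup>2 * real N powr (2 * (- 1 / p - e))"
    using powr_power[of "real N" "- 1 / p - e" 2] \<open>N \<ge> 1\<close> by (simp add: power_mult_distrib)
  finally have 1: "x\<^sup>2 \<le> c\<^sup>2 * real N powr (2 * (- 1 / p - e))" .
  have "(2 * real N + 1) powr (2 / p) \<le> (3 * real N) powr (2 / p)"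
    using assms by (intro powr_mono2) auto
  also have "\<dots> = 3 powr (2 / p) * real N powr (2 / p)" by (simp add: powr_mult)
  finally have "x\<^sup>2 * (2 * real N + 1) powr (2 / p)
      \<le> (c\<^sup>2 * real N powr (2 * (- 1 / p - e))) * (3 powr (2 / p) * real N powr (2 / p))"
    using 1 by (intro mult_mono) auto
  also have "\<dots> = 3 powr (2 / p) * c\<^sup>2 * (real N powr (2 * (- 1 / p - e)) * real N powr (2 / p))" by simp
  also have "real N powr (2 * (- 1 / p - e)) * real N powr (2 / p) = real N powr (- 2 * e)"
    unfolding powr_add[symmetric] by (rule arg_cong) (simp add: algebra_simps)
  finally show ?thesis .
qed

text \<open>
  The error is a linear combination of the values of \<open>\<xi>\<close> at \<open>t\<close> and at the nodes, with the same
  coefficients as in the truncation error of each kernel function.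
\<close>

lemma truncation_second_moment_le:
  assumes P: "piranashvili_process M L f F \<xi>"
    and \<gamma>: "kernel_exponential_type L f = ereal \<gamma>" "\<gamma> < w"
    and bdd: "bdd_above {cmod (f (of_real t) l) | t l. l \<in> space L}" and "N \<ge> 1"
  shows "(LINT \<omega>|M. (cmod (\<xi> t \<omega> - (\<Sum>n\<in>sampling_indices w N t. \<xi> (of_int n * pi / w) \<omega> * of_real (sinc (w * t - of_int n * pi)))))\<^sup>2)
       \<le> (truncation_const (kernel_bound L f) w \<gamma> t / real N)\<^sup>2 * total_variation (L \<Otimes>\<^sub>M L) F"
proof -
  have ne: "space L \<noteq> {}"
    using \<gamma>(1) by (auto simp: kernel_exponential_type_def bot_ereal_def)
  then obtain l0 where l0: "l0 \<in> space L" by blast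
  have ls: "limsup (\<lambda>n. ereal (root n (cmod ((deriv ^^ n) (\<lambda>z. f z l) 0)))) \<le> ereal \<gamma>" if "l \<in> space L" for l
    unfolding \<gamma>(1)[symmetric] kernel_exponential_type_def by (rule SUP_upper[OF that])
  have "0 \<le> limsup (\<lambda>n. ereal (root n (cmod ((deriv ^^ n) (\<lambda>z. f z l0) 0))))"
    by (intro le_Limsup always_eventually allI) (auto intro: real_root_ge_zero)
  then have \<gamma>0: "0 \<le> \<gamma>" using ls[OF l0] by (metis ereal_less_eq(5) order_trans)
  obtain b where b: "\<And>t l. l \<in> space L \<Longrightarrow> cmod (f (of_real t) l) \<le> b"
    using bdd by (auto simp: bdd_above_def)
  have K: "cmod (f (of_real x) l) \<le> kernel_bound L f" if "l \<in> space L" for x l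
  proof -
    have "cmod (f (of_real x) l) \<le> (SUP l\<in>space L. cmod (f (of_real x) l))"
      using b by (intro cSUP_upper[OF that] bdd_aboveI2)
    also have "\<dots> \<le> kernel_bound L f"
      unfolding kernel_bound_def using b ne
      by (intro cSUP_upper bdd_aboveI2[where M = b] cSUP_least) auto
    finally show ?thesis .
  qed
  have K0: "kernel_bound L f \<ge> 0" using order_trans[OF norm_ge_zero K[OF l0]] .
  have T0: "truncation_const (kernel_bound L f) w \<gamma> t / real N \<ge> 0"
    using K0 \<gamma>(2) \<gamma>0 unfolding truncation_const_def by (intro divide_nonneg_nonneg mult_nonneg_nonneg) auto
  define J where "J = sampling_indices w N t"
  have finJ: "finite J" by (simp add: J_def sampling_indices_eq)
  \<comment> \<open>The index \<open>None\<close> stands for the point \<open>t\<close>, which may coincide with a node.\<close>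
  define I where "I = insert None (Some ` J)"
  define \<tau> where "\<tau> = (\<lambda>i. case i of None \<Rightarrow> t | Some n \<Rightarrow> of_int n * pi / w)"
  define c where "c = (\<lambda>i. case i of None \<Rightarrow> 1 | Some n \<Rightarrow> - complex_of_real (sinc (w * t - of_int n * pi)))"
  have sumI: "(\<Sum>i\<in>I. c i * g (\<tau> i)) = g t - (\<Sum>n\<in>J. g (of_int n * pi / w) * of_real (sinc (w * t - of_int n * pi)))"
    for g :: "real \<Rightarrow> complex"
    unfolding I_def using finJ
    by (subst sum.insert) (auto simp: sum.reindex c_def \<tau>_def sum_negf mult.commute simp del: of_real_divide)
  have "(LINT \<omega>|M. (cmod (\<Sum>i\<in>I. c i * \<xi> (\<tau> i) \<omega>))\<^sup>2)
      \<le> (truncation_const (kernel_bound L f) w \<gamma> t / real N)\<^sup>2 * total_variation (L \<Otimes>\<^sub>M L) F"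
  proof (rule piranashvili_second_moment_le[OF P K])
    show "cmod (\<Sum>i\<in>I. c i * f (of_real (\<tau> i)) l) \<le> truncation_const (kernel_bound L f) w \<gamma> t / real N"
      if "l \<in> space L" for l
      unfolding sumI[of "\<lambda>x. f (of_real x) l"] J_def
    proof (rule kernel_truncation_error[OF _ ls[OF that] \<gamma>0 \<gamma>(2) \<open>N \<ge> 1\<close> K[OF that]])
      show "(\<lambda>z. f z l) holomorphic_on UNIV" using P that by (simp add: piranashvili_process_def)
    qed
  qed (use T0 finJ in \<open>auto simp: I_def\<close>)
  then show ?thesis unfolding sumI[of "\<lambda>x. \<xi> x _"] J_def .
qed

lemma averaging_second_moment_le:
  assumes \<xi>: "\<And>t. square_integrable M (\<xi> t)" and B: "C2_plane (covariance M \<xi>)"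
    and bdd: "bdd_above (range (\<lambda>x. cmod (mixed_deriv (covariance M \<xi>) x x)))"
    and pq: "1 < p" "1 / p + 1 / q = 1"
    and av: "averaging_functions w \<sigma>' \<sigma>'' u"
    and Y: "\<And>n. has_ms_integral M (\<lambda>x \<omega>. \<xi> x \<omega> * of_real (u t n x)) (Y t n) (averaging_window w \<sigma>' \<sigma>'' t n)"
    and "N \<ge> 1"
  shows "(LINT \<omega>|M. (cmod ((\<Sum>n\<in>sampling_indices w N t. \<xi> (of_int n * pi / w) \<omega> * of_real (sinc (w * t - of_int n * pi)))
            - average_sampling_sum w N Y t \<omega>))\<^sup>2)
       \<le> (averaging_width w N \<sigma>' \<sigma>'')\<^sup>2 * averaging_const w q t
            * (SUP x. cmod (mixed_deriv (covariance M \<xi>) x x)) * (2 * real N + 1) powr (2 / p)"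
proof -
  define D where "D = (SUP x. cmod (mixed_deriv (covariance M \<xi>) x x))"
  define s where "s = averaging_width w N \<sigma>' \<sigma>''"
  have D: "cmod (mixed_deriv (covariance M \<xi>) x x) \<le> D" for x
    unfolding D_def by (rule cSUP_upper[OF _ bdd]) simp
  have D0: "D \<ge> 0" using order_trans[OF norm_ge_zero D[of 0]] .
  have Ysq: "square_integrable M (Y t n)" for n using Y by (simp add: has_ms_integral_def)
  have err: "(LINT \<omega>|M. (cmod (\<xi> (of_int n * pi / w) \<omega> - Y t n \<omega>))\<^sup>2) \<le> D * s\<^sup>2"
    if n: "n \<in> sampling_indices w N t" for n
  proof (rule mean_square_average_error[OF \<xi> mean_square_Lipschitz[OF \<xi> B D] D0 Y[unfolded averaging_window_def]])
    show "0 \<le> u t n x" for x using av by (simp add: averaging_functions_def)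
    show "(u t n has_integral 1) {of_int n * pi / w - \<sigma>' t n..of_int n * pi / w + \<sigma>'' t n}"
      using av by (simp add: averaging_functions_def averaging_window_def)
    show "\<bar>x - of_int n * pi / w\<bar> \<le> s" if "x \<in> {of_int n * pi / w - \<sigma>' t n..of_int n * pi / w + \<sigma>'' t n}" for x
      using that averaging_width_upper[OF av \<open>N \<ge> 1\<close> n] unfolding s_def by (auto simp: abs_le_iff)
  qed
  have "(LINT \<omega>|M. (cmod (\<Sum>n\<in>sampling_indices w N t. of_real (sinc (w * t - of_int n * pi)) * (\<xi> (of_int n * pi / w) \<omega> - Y t n \<omega>)))\<^sup>2)
      \<le> (\<Sum>n\<in>sampling_indices w N t. cmod (of_real (sinc (w * t - of_int n * pi))))\<^sup>2 * (D * s\<^sup>2)"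
    by (intro second_moment_sum_le square_integrable_diff \<xi> Ysq err)
  also have "\<dots> \<le> (averaging_const w q t * (2 * real N + 1) powr (2 / p)) * (D * s\<^sup>2)"
    unfolding norm_of_real using D0 by (intro mult_right_mono sum_abs_sinc_power2_le pq) auto
  finally have "(LINT \<omega>|M. (cmod (\<Sum>n\<in>sampling_indices w N t. of_real (sinc (w * t - of_int n * pi)) * (\<xi> (of_int n * pi / w) \<omega> - Y t n \<omega>)))\<^sup>2)
      \<le> (averaging_const w q t * (2 * real N + 1) powr (2 / p)) * (D * s\<^sup>2)" .
  moreover have "(\<Sum>n\<in>sampling_indices w N t. of_real (sinc (w * t - of_int n * pi)) * (\<xi> (of_int n * pi / w) \<omega> - Y t n \<omega>))
      = (\<Sum>n\<in>sampling_indices w N t. \<xi> (of_int n * pi / w) \<omega> * of_real (sinc (w * t - of_int n * pi)))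
            - average_sampling_sum w N Y t \<omega>" for \<omega>
    unfolding average_sampling_sum_def sum_subtractf[symmetric] by (simp only: right_diff_distrib left_diff_distrib mult.commute)
  ultimately show ?thesis unfolding D_def[symmetric] s_def[symmetric] by (simp add: mult_ac)
qed

lemma average_sampling_error:
  assumes P: "piranashvili_process M L f F \<xi>"
    and \<gamma>: "kernel_exponential_type L f = ereal \<gamma>" "\<gamma> < w"
    and fbdd: "bdd_above {cmod (f (of_real t) l) | t l. l \<in> space L}"
    and B: "C2_plane (covariance M \<xi>)"
    and bdd: "bdd_above (range (\<lambda>x. cmod (mixed_deriv (covariance M \<xi>) x x)))"
    and pq: "1 < p" "1 / p + 1 / q = 1"
    and av: "averaging_functions w \<sigma>' \<sigma>'' u"
    and Y: "\<And>n. has_ms_integral M (\<lambda>x \<omega>. \<xi> x \<omega> * of_real (u t n x)) (Y t n) (averaging_window w \<sigma>' \<sigma>'' t n)"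
    and "N \<ge> 1"
  shows "(LINT \<omega>|M. (cmod (\<xi> t \<omega> - average_sampling_sum w N Y t \<omega>))\<^sup>2)
       \<le> 2 * (truncation_const (kernel_bound L f) w \<gamma> t)\<^sup>2 / (real N)\<^sup>2 * total_variation (L \<Otimes>\<^sub>M L) F
         + 2 * (averaging_width w N \<sigma>' \<sigma>'')\<^sup>2 * averaging_const w q t
            * (SUP x. cmod (mixed_deriv (covariance M \<xi>) x x)) * (2 * real N + 1) powr (2 / p)"
proof -
  have \<xi>: "square_integrable M (\<xi> t)" for t using P by (simp add: piranashvili_process_def)
  have Ysq: "square_integrable M (Y t n)" for n using Y by (simp add: has_ms_integral_def)
  define S where "S = (\<lambda>\<omega>. \<Sum>n\<in>sampling_indices w N t. \<xi> (of_int n * pi / w) \<omega> * of_real (sinc (w * t - of_int n * pi)))"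
  define A where "A = average_sampling_sum w N Y t"
  have Ssq: "square_integrable M S"
    unfolding S_def by (subst mult.commute) (intro square_integrable_sum square_integrable_cmult \<xi>)
  have Asq: "square_integrable M A"
    unfolding A_def average_sampling_sum_def[abs_def]
    by (subst mult.commute) (intro square_integrable_sum square_integrable_cmult Ysq)
  have "(LINT \<omega>|M. (cmod (\<xi> t \<omega> - A \<omega>))\<^sup>2) \<le> (LINT \<omega>|M. 2 * (cmod (\<xi> t \<omega> - S \<omega>))\<^sup>2 + 2 * (cmod (S \<omega> - A \<omega>))\<^sup>2)"
  proof (rule integral_mono)
    show "(cmod (\<xi> t \<omega> - A \<omega>))\<^sup>2 \<le> 2 * (cmod (\<xi> t \<omega> - S \<omega>))\<^sup>2 + 2 * (cmod (S \<omega> - A \<omega>))\<^sup>2" for \<omega>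
      using norm_add_power2_le[of 1 "\<xi> t \<omega> - S \<omega>" "S \<omega> - A \<omega>"] by simp
  qed (intro square_integrableD square_integrable_diff Bochner_Integration.integrable_add integrable_mult_right \<xi> Ssq Asq)+
  also have "\<dots> = 2 * (LINT \<omega>|M. (cmod (\<xi> t \<omega> - S \<omega>))\<^sup>2) + 2 * (LINT \<omega>|M. (cmod (S \<omega> - A \<omega>))\<^sup>2)"
    using square_integrableD[OF square_integrable_diff[OF \<xi> Ssq]] square_integrableD[OF square_integrable_diff[OF Ssq Asq]] by simp
  also have "\<dots> \<le> 2 * ((truncation_const (kernel_bound L f) w \<gamma> t / real N)\<^sup>2 * total_variation (L \<Otimes>\<^sub>M L) F)
      + 2 * ((averaging_width w N \<sigma>' \<sigma>'')\<^sup>2 * averaging_const w q t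
            * (SUP x. cmod (mixed_deriv (covariance M \<xi>) x x)) * (2 * real N + 1) powr (2 / p))"
    using truncation_second_moment_le[OF P \<gamma> fbdd \<open>N \<ge> 1\<close>, of t]
      averaging_second_moment_le[where M = M and \<xi> = \<xi> and Y = Y and u = u and t = t, OF \<xi> B bdd pq av Y \<open>N \<ge> 1\<close>]
    unfolding S_def A_def by (intro add_mono mult_left_mono) auto
  finally show ?thesis unfolding A_def by (simp add: power_divide mult.assoc)
qed

theorem theorem3:
  fixes M :: "'a measure" and L :: "real measure"
    and f :: "complex \<Rightarrow> real \<Rightarrow> complex" and F :: "(real \<times> real) set \<Rightarrow> complex"
    and \<xi> :: "real \<Rightarrow> 'a \<Rightarrow> complex"
    and \<gamma> w p q :: real
    and \<sigma>' \<sigma>'' :: "nat \<Rightarrow> real \<Rightarrow> int \<Rightarrow> real"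
    and u :: "nat \<Rightarrow> real \<Rightarrow> int \<Rightarrow> real \<Rightarrow> real"
    and Y :: "nat \<Rightarrow> real \<Rightarrow> int \<Rightarrow> 'a \<Rightarrow> complex"
  defines "B \<equiv> covariance M \<xi>"
    and "\<sigma> \<equiv> (\<lambda>N. averaging_width w N (\<sigma>' N) (\<sigma>'' N))"
    and "\<A> \<equiv> (\<lambda>N. average_sampling_sum w N (Y N))"
  assumes "piranashvili_process M L f F \<xi>"
    and "kernel_exponential_type L f = ereal \<gamma>" and "\<gamma> < w"
    and "bdd_above {cmod (f (of_real t) l) | t l. l \<in> space L}"
    and "C2_plane B" and "bdd_above (range (\<lambda>x. cmod (mixed_deriv B x x)))"
    and "1 < p" and "1 / p + 1 / q = 1"
    and "\<And>N. averaging_functions w (\<sigma>' N) (\<sigma>'' N) (u N)"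
    and "\<And>N t n. has_ms_integral M (\<lambda>x \<omega>. \<xi> x \<omega> * of_real (u N t n x)) (Y N t n)
                    (averaging_window w (\<sigma>' N) (\<sigma>'' N) t n)"
  shows "(\<forall>t. \<forall>\<^sub>F N in sequentially.
            (LINT \<omega>|M. (cmod (\<xi> t \<omega> - \<A> N t \<omega>))\<^sup>2)
              \<le> 2 * (truncation_const (kernel_bound L f) w \<gamma> t)\<^sup>2 / (real N)\<^sup>2
                  * total_variation (L \<Otimes>\<^sub>M L) F
                + 2 * (\<sigma> N)\<^sup>2 * averaging_const w q t
                  * (SUP x. cmod (mixed_deriv B x x)) * (2 * real N + 1) powr (2 / p)) \<and>
         (\<sigma> \<in> o(\<lambda>N. real N powr (- 1 / p)) \<longrightarrow>
            (\<forall>t. (\<lambda>N. LINT \<omega>|M. (cmod (\<xi> t \<omega> - \<A> N t \<omega>))\<^sup>2) \<longlonglongrightarrow> 0)) \<and>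
         (\<forall>\<epsilon>>0. \<sigma> \<in> O(\<lambda>N. real N powr (- 1 / 2 - 1 / p - \<epsilon>)) \<longrightarrow>
            (\<forall>t. measure M {\<omega> \<in> space M. (\<lambda>N. \<A> N t \<omega>) \<longlonglongrightarrow> \<xi> t \<omega>} = 1))"
proof -
  note P = assms(4) and \<gamma> = assms(5,6) and fbdd = assms(7) and pq = assms(10,11)
  have Bc: "C2_plane (covariance M \<xi>)" and Bbdd: "bdd_above (range (\<lambda>x. cmod (mixed_deriv (covariance M \<xi>) x x)))"
    using assms(8,9) by (simp_all add: B_def)
  have \<xi>: "square_integrable M (\<xi> t)" for t using P by (simp add: piranashvili_process_def)
  have Ysq: "square_integrable M (Y N t n)" for N t n using assms(13) by (simp add: has_ms_integral_def)
  have Asq: "square_integrable M (\<A> N t)" for N t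
    unfolding \<A>_def average_sampling_sum_def[abs_def]
    by (subst mult.commute) (intro square_integrable_sum square_integrable_cmult Ysq)
  define E where "E = (\<lambda>t N. LINT \<omega>|M. (cmod (\<xi> t \<omega> - \<A> N t \<omega>))\<^sup>2)"
  define C1 where "C1 = (\<lambda>t. 2 * (truncation_const (kernel_bound L f) w \<gamma> t)\<^sup>2 * total_variation (L \<Otimes>\<^sub>M L) F)"
  define C2 where "C2 = (\<lambda>t. 2 * averaging_const w q t * (SUP x. cmod (mixed_deriv B x x)))"
  have E0: "E t N \<ge> 0" for t N unfolding E_def by simp
  have bound: "E t N \<le> 2 * (truncation_const (kernel_bound L f) w \<gamma> t)\<^sup>2 / (real N)\<^sup>2 * total_variation (L \<Otimes>\<^sub>M L) F
                + 2 * (\<sigma> N)\<^sup>2 * averaging_const w q t * (SUP x. cmod (mixed_deriv B x x)) * (2 * real N + 1) powr (2 / p)"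
    if "N \<ge> 1" for t N
    unfolding E_def \<A>_def \<sigma>_def B_def
    by (rule average_sampling_error[OF P \<gamma> fbdd Bc Bbdd pq assms(12,13) that])
  have bound': "E t N \<le> C1 t / (real N)\<^sup>2 + C2 t * (\<bar>\<sigma> N\<bar>\<^sup>2 * (2 * real N + 1) powr (2 / p))" if "N \<ge> 1" for t N
    using bound[OF that, of t] by (simp add: C1_def C2_def mult_ac)
  have C20: "C2 t \<ge> 0" for t
  proof -
    have "0 \<le> cmod (mixed_deriv B 0 0)" by simp
    also have "\<dots> \<le> (SUP x. cmod (mixed_deriv B x x))" by (rule cSUP_upper[OF _ assms(9)]) simp
    finally show ?thesis by (simp add: C2_def averaging_const_def)
  qed
  have lim1: "(\<lambda>N. C1 t / (real N)\<^sup>2) \<longlonglongrightarrow> 0" for t by real_asymp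
  have part2: "E t \<longlonglongrightarrow> 0" if o: "\<sigma> \<in> o(\<lambda>N. real N powr (- 1 / p))" for t
  proof -
    define r where "r = (\<lambda>N. \<sigma> N / real N powr (- 1 / p))"
    have r: "r \<longlonglongrightarrow> 0" unfolding r_def using o by (rule smalloD_tendsto)
    have le: "E t N \<le> C1 t / (real N)\<^sup>2 + C2 t * (3 powr (2 / p) * \<bar>r N\<bar>\<^sup>2)" if N: "N \<ge> 1" for N
    proof -
      have "\<bar>\<sigma> N\<bar> \<le> \<bar>r N\<bar> * real N powr (- 1 / p - 0)" using N by (simp add: r_def abs_divide)
      then have "\<bar>\<sigma> N\<bar>\<^sup>2 * (2 * real N + 1) powr (2 / p) \<le> 3 powr (2 / p) * \<bar>r N\<bar>\<^sup>2 * real N powr (- 2 * 0)"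
        using N pq(1) by (intro width_term_le) auto
      then have "C2 t * (\<bar>\<sigma> N\<bar>\<^sup>2 * (2 * real N + 1) powr (2 / p)) \<le> C2 t * (3 powr (2 / p) * \<bar>r N\<bar>\<^sup>2)"
        using N by (intro mult_left_mono C20) auto
      then show ?thesis using bound'[OF N, of t] by linarith
    qed
    have "(\<lambda>N. C1 t / (real N)\<^sup>2 + C2 t * (3 powr (2 / p) * \<bar>r N\<bar>\<^sup>2)) \<longlonglongrightarrow> 0 + C2 t * (3 powr (2 / p) * \<bar>0\<bar>\<^sup>2)"
      by (intro tendsto_intros lim1 r)
    then have lim: "(\<lambda>N. C1 t / (real N)\<^sup>2 + C2 t * (3 powr (2 / p) * \<bar>r N\<bar>\<^sup>2)) \<longlonglongrightarrow> 0" by simp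
    show ?thesis
    proof (rule tendsto_sandwich[OF _ _ tendsto_const lim])
      show "\<forall>\<^sub>F N in sequentially. E t N \<le> C1 t / (real N)\<^sup>2 + C2 t * (3 powr (2 / p) * \<bar>r N\<bar>\<^sup>2)"
        using eventually_ge_at_top[of "1::nat"] by (rule eventually_mono) (rule le)
    qed (simp add: E0)
  qed
  have part3: "measure M {\<omega> \<in> space M. (\<lambda>N. \<A> N t \<omega>) \<longlonglongrightarrow> \<xi> t \<omega>} = 1"
    if "\<epsilon> > 0" and O: "\<sigma> \<in> O(\<lambda>N. real N powr (- 1 / 2 - 1 / p - \<epsilon>))" for \<epsilon> t
  proof -
    interpret prob_space M using P by (simp add: piranashvili_process_def)
    obtain c where c: "\<forall>\<^sub>F N in sequentially. norm (\<sigma> N) \<le> c * norm (real N powr (- 1 / 2 - 1 / p - \<epsilon>))"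
      using O by (elim landau_o.bigE)
    have "summable (\<lambda>N. C1 t * (1 / (real N)\<^sup>2) + C2 t * 3 powr (2 / p) * c\<^sup>2 * real N powr (- 2 * (1 / 2 + \<epsilon>)))"
      using \<open>\<epsilon> > 0\<close> inverse_power_summable[of 2, where 'a = real]
      by (intro summable_add summable_mult) (simp_all add: summable_real_powr_iff inverse_eq_divide)
    then have "summable (E t)"
    proof (rule summable_comparison_test_ev[rotated])
      show "\<forall>\<^sub>F N in sequentially. norm (E t N) \<le> C1 t * (1 / (real N)\<^sup>2)
          + C2 t * 3 powr (2 / p) * c\<^sup>2 * real N powr (- 2 * (1 / 2 + \<epsilon>))"
        using c eventually_ge_at_top[of "1::nat"]
      proof eventually_elim
        case (elim N)
        have "\<bar>\<sigma> N\<bar> \<le> c * real N powr (- 1 / p - (1 / 2 + \<epsilon>))"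
        proof -
          have "- 1 / p - (1 / 2 + \<epsilon>) = - 1 / 2 - 1 / p - \<epsilon>" by simp
          then show ?thesis using elim(1) by (simp only:) simp
        qed
        then have "\<bar>\<sigma> N\<bar>\<^sup>2 * (2 * real N + 1) powr (2 / p)
            \<le> 3 powr (2 / p) * c\<^sup>2 * real N powr (- 2 * (1 / 2 + \<epsilon>))"
          using elim(2) pq(1) by (intro width_term_le) auto
        then have "C2 t * (\<bar>\<sigma> N\<bar>\<^sup>2 * (2 * real N + 1) powr (2 / p))
            \<le> C2 t * (3 powr (2 / p) * c\<^sup>2 * real N powr (- 2 * (1 / 2 + \<epsilon>)))"
          by (rule mult_left_mono) (rule C20)
        moreover have "norm (E t N) = E t N" using E0 by simp
        ultimately show ?case using bound'[OF elim(2), of t] by (simp add: mult.assoc)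
      qed
    qed
    then have "AE \<omega> in M. (\<lambda>N. \<xi> t \<omega> - \<A> N t \<omega>) \<longlonglongrightarrow> 0"
      unfolding E_def by (intro AE_tendsto_0_if_summable_second_moments square_integrable_diff \<xi> Asq)
    then have AE: "AE \<omega> in M. (\<lambda>N. \<A> N t \<omega>) \<longlonglongrightarrow> \<xi> t \<omega>"
    proof eventually_elim
      case (elim \<omega>)
      then have "(\<lambda>N. \<xi> t \<omega> - (\<xi> t \<omega> - \<A> N t \<omega>)) \<longlonglongrightarrow> \<xi> t \<omega> - 0"
        by (intro tendsto_diff tendsto_const)
      then show ?case by simp
    qed
    have [measurable]: "\<A> N t \<in> borel_measurable M" "\<xi> t \<in> borel_measurable M" for N
      using Asq \<xi> by (simp_all add: square_integrable_def)
    have "{\<omega> \<in> space M. (\<lambda>N. \<A> N t \<omega>) \<longlonglongrightarrow> \<xi> t \<omega>}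
        = {\<omega> \<in> space M. (\<lambda>N. cmod (\<A> N t \<omega> - \<xi> t \<omega>)) \<longlonglongrightarrow> 0}"
      by (simp add: tendsto_norm_zero_iff LIM_zero_iff)
    also have "\<dots> \<in> sets M" by measurable
    finally have "{\<omega> \<in> space M. (\<lambda>N. \<A> N t \<omega>) \<longlonglongrightarrow> \<xi> t \<omega>} \<in> sets M" .
    from prob_Collect_eq_1[OF this] AE show ?thesis by simp
  qed
  show ?thesis
  proof (intro conjI allI impI)
    fix t
    show "\<forall>\<^sub>F N in sequentially. (LINT \<omega>|M. (cmod (\<xi> t \<omega> - \<A> N t \<omega>))\<^sup>2)
        \<le> 2 * (truncation_const (kernel_bound L f) w \<gamma> t)\<^sup>2 / (real N)\<^sup>2 * total_variation (L \<Otimes>\<^sub>M L) F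
          + 2 * (\<sigma> N)\<^sup>2 * averaging_const w q t * (SUP x. cmod (mixed_deriv B x x)) * (2 * real N + 1) powr (2 / p)"
      using eventually_ge_at_top[of "1::nat"]
      by (rule eventually_mono) (rule bound[unfolded E_def])
  qed (use part2 part3 in \<open>auto simp: E_def\<close>)
qed

end
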